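(* Let $G$ be a finitely generated, residually torsion-free nilpotent group, and let $LO(G)$ be the space of left-invariant orderings on $G$. Then the map $\psi_a:\operatorname{Aut}(G)\to\operatorname{Homeo}(LO(G))$, which sends $\phi\in\operatorname{Aut}(G)$ to the homeomorphism $\leq\;\mapsto\;\leq_\phi$ of $LO(G)$, where $g\leq_\phi h$ if and only if $\phi(g)\leq\phi(h)$, is injective.
   Context: A group $G$ is residually torsion-free nilpotent if every non-identity element of $G$ has non-trivial image in some torsion-free nilpotent quotient of $G$. A left-invariant ordering on $G$ is a total ordering $\leq$ on $G$ such that $a\leq b$ implies $ca\leq cb$ for all $a,b,c\in G$. It is determined by its positive cone $\mathcal{P}=\{g\in G: 1<g\}$ (with $g<h$ if and only if $g^{-1}h\in\mathcal{P}$). The positive cones are exactly the subsets $\mathcal{P}\subset G$ with $\mathcal{P}\cup\mathcal{P}^{-1}=G\setminus\{1\}$, $\mathcal{P}\cap\mathcal{P}^{-1}=\emptyset$ and $\mathcal{P}\cdot\mathcal{P}\subset\mathcal{P}$. $LO(G)$ is the set of all left-invariant orderings, identified with the set of positive cones and topologized as a (closed) subspace of $\{0,1\}^G$ with the product topology, $\{0,1\}$ being discrete. Each map $\leq\;\mapsto\;\leq_\phi$ is a homeomorphism of $LO(G)$. *)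

theory Defs
  imports
    "HOL-Algebra.Bij"
    "HOL-Algebra.Generated_Groups"
    "HOL-Analysis.Function_Topology"
begin

section \<open>Residually torsion-free nilpotent groups\<close>

definition finitely_generated_group :: "('a, 'b) monoid_scheme \<Rightarrow> bool" where
  "finitely_generated_group G \<longleftrightarrow>
     group G \<and> (\<exists>S. finite S \<and> S \<subseteq> carrier G \<and> generate G S = carrier G)"

definition torsion_free_group :: "('a, 'b) monoid_scheme \<Rightarrow> bool" where
  "torsion_free_group G \<longleftrightarrow>
     group G \<and>
     (\<forall>x\<in>carrier G. \<forall>n::nat. n > 0 \<and> x [^]\<^bsub>G\<^esub> n = \<one>\<^bsub>G\<^esub> \<longrightarrow> x = \<one>\<^bsub>G\<^esub>)"

text \<open>The series is indexed from \<open>0\<close>, so \<open>lower_central G n\<close> is the term usually written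
  \<open>\<gamma>\<close> with index \<open>n + 1\<close>.\<close>

primrec lower_central :: "('a, 'b) monoid_scheme \<Rightarrow> nat \<Rightarrow> 'a set" where
  "lower_central G 0 = carrier G"
| "lower_central G (Suc n) =
     generate G (\<Union>x\<in>lower_central G n. \<Union>y\<in>carrier G.
       {x \<otimes>\<^bsub>G\<^esub> y \<otimes>\<^bsub>G\<^esub> inv\<^bsub>G\<^esub> x \<otimes>\<^bsub>G\<^esub> inv\<^bsub>G\<^esub> y})"

definition nilpotent_group :: "('a, 'b) monoid_scheme \<Rightarrow> bool" where
  "nilpotent_group G \<longleftrightarrow> group G \<and> (\<exists>n. lower_central G n = {\<one>\<^bsub>G\<^esub>})"

text \<open>\<open>N #>\<^bsub>G\<^esub> g\<close> is the image of \<open>g\<close> in the quotient \<open>G Mod N\<close>.\<close>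

definition residually_torsion_free_nilpotent :: "('a, 'b) monoid_scheme \<Rightarrow> bool" where
  "residually_torsion_free_nilpotent G \<longleftrightarrow>
     group G \<and>
     (\<forall>g\<in>carrier G. g \<noteq> \<one>\<^bsub>G\<^esub> \<longrightarrow>
        (\<exists>N. N \<lhd> G \<and> torsion_free_group (G Mod N) \<and> nilpotent_group (G Mod N) \<and>
             N #>\<^bsub>G\<^esub> g \<noteq> \<one>\<^bsub>G Mod N\<^esub>))"


section \<open>The space of left-invariant orderings\<close>

text \<open>An ordering is the relation \<open>\<le>\<close>, i.e. the set of pairs \<open>(a, b)\<close> with \<open>a \<le> b\<close>;
  \<^const>\<open>linear_order_on\<close> requires it to be a subset of \<open>carrier G \<times> carrier G\<close>.\<close>

definition left_orders :: "('a, 'b) monoid_scheme \<Rightarrow> 'a rel set" where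
  "left_orders G =
     {R. linear_order_on (carrier G) R \<and>
         (\<forall>a\<in>carrier G. \<forall>b\<in>carrier G. \<forall>c\<in>carrier G.
            (a, b) \<in> R \<longrightarrow> (c \<otimes>\<^bsub>G\<^esub> a, c \<otimes>\<^bsub>G\<^esub> b) \<in> R)}"

definition positive_cone :: "('a, 'b) monoid_scheme \<Rightarrow> 'a rel \<Rightarrow> 'a set" where
  "positive_cone G R = {g \<in> carrier G. (\<one>\<^bsub>G\<^esub>, g) \<in> R \<and> g \<noteq> \<one>\<^bsub>G\<^esub>}"

text \<open>The subspace topology coming from \<open>{0,1}\<close> to the power \<open>G\<close>, where an ordering is identified
  with the indicator function of its positive cone (on \<^term>\<open>carrier G\<close>, with values in the discrete
  space \<^typ>\<open>bool\<close>). The identification is injective by \<open>inj_on_positive_cone\<close> below.\<close>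

definition LO :: "('a, 'b) monoid_scheme \<Rightarrow> 'a rel topology" where
  "LO G = pullback_topology (left_orders G)
     (\<lambda>R. \<lambda>g\<in>carrier G. g \<in> positive_cone G R)
     (product_topology (\<lambda>_. discrete_topology (UNIV :: bool set)) (carrier G))"

lemma topspace_LO [simp]: "topspace (LO G) = left_orders G"
  by (auto simp: LO_def topspace_pullback_topology)

lemma left_orders_iff_positive_cone:
  assumes "group G" and R: "R \<in> left_orders G" and g: "g \<in> carrier G" and h: "h \<in> carrier G"
  shows "(g, h) \<in> R \<and> g \<noteq> h \<longleftrightarrow> inv\<^bsub>G\<^esub> g \<otimes>\<^bsub>G\<^esub> h \<in> positive_cone G R"
proof -
  interpret group G by fact
  have inv_R: "(c \<otimes>\<^bsub>G\<^esub> a, c \<otimes>\<^bsub>G\<^esub> b) \<in> R"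
    if "(a, b) \<in> R" "a \<in> carrier G" "b \<in> carrier G" "c \<in> carrier G" for a b c
    using R that by (auto simp: left_orders_def)
  have *: "g \<otimes>\<^bsub>G\<^esub> (inv\<^bsub>G\<^esub> g \<otimes>\<^bsub>G\<^esub> h) = h"
    using g h by (simp flip: m_assoc)
  have "inv\<^bsub>G\<^esub> g \<otimes>\<^bsub>G\<^esub> h = \<one>\<^bsub>G\<^esub> \<longleftrightarrow> g = h"
    using g h * by (metis l_inv r_one)
  moreover have "(\<one>\<^bsub>G\<^esub>, inv\<^bsub>G\<^esub> g \<otimes>\<^bsub>G\<^esub> h) \<in> R \<longleftrightarrow> (g, h) \<in> R"
    using inv_R[of g h "inv\<^bsub>G\<^esub> g"] inv_R[of "\<one>\<^bsub>G\<^esub>" "inv\<^bsub>G\<^esub> g \<otimes>\<^bsub>G\<^esub> h" g] g h *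
    by auto
  ultimately show ?thesis
    using g h by (auto simp: positive_cone_def)
qed

lemma inj_on_positive_cone:
  assumes "group G"
  shows "inj_on (positive_cone G) (left_orders G)"
proof (rule inj_onI)
  fix R R' assume R: "R \<in> left_orders G" "R' \<in> left_orders G"
    and eq: "positive_cone G R = positive_cone G R'"
  have sub: "R \<subseteq> carrier G \<times> carrier G" "R' \<subseteq> carrier G \<times> carrier G"
    and refl: "refl_on (carrier G) R" "refl_on (carrier G) R'"
    using R by (auto simp: left_orders_def order_on_defs)
  have "(g, h) \<in> R \<longleftrightarrow> (g, h) \<in> R'" if "g \<in> carrier G" "h \<in> carrier G" for g h
  proof (cases "g = h")
    case True
    then show ?thesis using refl that by (simp add: refl_on_def)
  next
    case False
    then show ?thesis
      using left_orders_iff_positive_cone[OF assms R(1) that]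
        left_orders_iff_positive_cone[OF assms R(2) that] eq by simp
  qed
  then show "R = R'" using sub by auto
qed


section \<open>The action of automorphisms\<close>

text \<open>As in \<^const>\<open>Bij\<close> and \<^const>\<open>auto\<close>, maps are taken to be extensional, so that equality of
  functions is equality of maps on the space.\<close>

definition Homeo :: "'a topology \<Rightarrow> ('a \<Rightarrow> 'a) set" where
  "Homeo X = {f \<in> extensional (topspace X). homeomorphic_map X X f}"

definition psi_a :: "('a, 'b) monoid_scheme \<Rightarrow> ('a \<Rightarrow> 'a) \<Rightarrow> 'a rel \<Rightarrow> 'a rel" where
  "psi_a G \<phi> = (\<lambda>R\<in>left_orders G. {(g, h) \<in> carrier G \<times> carrier G. (\<phi> g, \<phi> h) \<in> R})"

end

theory Submission
  imports Defs "HOL-Algebra.Elementary_Groups"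
begin

text \<open>Let \<open>\<alpha>\<close> be an automorphism preserving every left-ordering. It preserves every relatively convex
  subgroup \<open>K\<close>, since the order on \<open>G/K\<close> can be reversed independently of the order on \<open>K\<close>. If
  \<open>G/N\<close> is torsion-free nilpotent and non-trivial, finite generation gives a homomorphism \<open>f\<close>
  from \<open>G/N\<close> onto the integers, and for every \<open>g\<close> with \<open>f g = 1\<close> the subgroup \<open>\<langle>g\<rangle>N\<close> is relatively
  convex. Hence \<open>\<alpha>\<close> induces an automorphism of \<open>\<langle>g\<rangle>N/N\<close>, an infinite cyclic group, and it fixes \<open>gN\<close>
  because it preserves signs. The elements with \<open>f g = 1\<close> generate \<open>G\<close>, so \<open>\<alpha>\<close> acts trivially on
  \<open>G/N\<close>; as \<open>N\<close> varies, residual torsion-free nilpotence gives \<open>\<alpha> = 1\<close>.\<close>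

section \<open>Relatively convex subgroups\<close>

text \<open>Finite generation is used to obtain the map onto the integers, and without it the
  theorem fails: the additive rationals have just two orderings, and doubling preserves both. The
  obstacle is that \<langle>g\<rangle>N is in general not normal, so its relative convexity cannot
  come from ordering a quotient group. Relative cones are therefore formulated for cosets of
  arbitrary subgroups and composed along chains of subgroups. The condition f g = 1 makes G a
  semidirect product of ker f and the powers of g, so the central series over N can be climbed
  inside ker f while g is carried along. It also pins down the exponents: if \<alpha> g is g^a
  modulo N and a preimage of g is g^b modulo N, then f gives a b = 1. To turn a relative order over
  K into an order of G, some left-ordering on K is needed; one fixed ordering \<open>P0\<close> of
  G, restricted to K, provides it.\<close>

abbreviation (in group) comm :: "'a \<Rightarrow> 'a \<Rightarrow> 'a" where
  "comm x y \<equiv> x \<otimes> y \<otimes> inv x \<otimes> inv y"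

lemma (in group) mult_comm:
  assumes "x \<in> carrier G" "y \<in> carrier G"
  shows "x \<otimes> y = comm x y \<otimes> y \<otimes> x"
  using assms by (simp add: m_assoc inv_solve_left)

text \<open>\<open>P\<close> is the set of \<open>x\<close> with \<open>K < xK\<close> for an \<open>H\<close>-invariant total order on the left
  cosets of \<open>K\<close> in \<open>H\<close>. For \<open>K = 1\<close> these are the positive cones of \<open>H\<close>.\<close>

definition rel_cone :: "('a, 'b) monoid_scheme \<Rightarrow> 'a set \<Rightarrow> 'a set \<Rightarrow> 'a set \<Rightarrow> bool" where
  "rel_cone G H K P \<longleftrightarrow>
     subgroup H G \<and> subgroup K G \<and> K \<subseteq> H \<and> P \<subseteq> H \<and> K \<inter> P = {} \<and>
     (\<forall>x\<in>H. x \<in> K \<or> x \<in> P \<or> inv\<^bsub>G\<^esub> x \<in> P) \<and>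
     (\<forall>x\<in>P. \<forall>y\<in>P. x \<otimes>\<^bsub>G\<^esub> y \<in> P) \<and>
     (\<forall>x\<in>P. \<forall>k\<in>K. x \<otimes>\<^bsub>G\<^esub> k \<in> P \<and> k \<otimes>\<^bsub>G\<^esub> x \<in> P)"

text \<open>Antisymmetry is no clause of \<open>rel_cone\<close>: it follows because
  \<open>P\<close> is closed under products and avoids the identity, which lies in
  \<open>K\<close>.\<close>

lemma (in group) rel_cone_inv_notin:
  assumes "rel_cone G H K P" "x \<in> P"
  shows "inv x \<notin> P"
proof
  assume "inv x \<in> P"
  then have "x \<otimes> inv x \<in> P" using assms by (auto simp: rel_cone_def)
  moreover have "x \<in> carrier G" using assms by (auto simp: rel_cone_def dest: subgroup.subset)
  ultimately have "\<one> \<in> P" by simp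
  moreover have "\<one> \<in> K" using assms by (auto simp: rel_cone_def intro: subgroup.one_closed)
  ultimately show False using assms by (auto simp: rel_cone_def)
qed

lemma (in group) rel_cone_refl:
  "subgroup H G \<Longrightarrow> rel_cone G H H {}"
  by (auto simp: rel_cone_def)

text \<open>Lexicographic order: cosets of \<open>K\<close> decide first, and \<open>Q\<close>
  breaks ties inside \<open>K\<close>. A product of an element of \<open>P\<close> and one of
  \<open>Q \<subseteq> K\<close>, in either order, stays in \<open>P\<close> because
  \<open>P\<close> absorbs \<open>K\<close> on both sides.\<close>

lemma (in group) rel_cone_trans:
  assumes P: "rel_cone G H K P" and Q: "rel_cone G K L Q"
  shows "rel_cone G H L (P \<union> Q)"
  unfolding rel_cone_def
proof (intro conjI)
  show "\<forall>x\<in>H. x \<in> L \<or> x \<in> P \<union> Q \<or> inv x \<in> P \<union> Q"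
    using assms unfolding rel_cone_def by (metis UnCI)
qed (use assms in \<open>auto simp: rel_cone_def\<close>)

text \<open>The reversed order on the cosets. Inversion swaps left and right factors, so the two
  absorption clauses exchange roles.\<close>

lemma (in group) rel_cone_flip:
  assumes P: "rel_cone G H K P"
  shows "rel_cone G H K (m_inv G ` P)"
proof -
  have H: "subgroup H G" and K: "subgroup K G" "K \<subseteq> H" and PH: "P \<subseteq> H" and KP: "K \<inter> P = {}"
    and total: "\<And>x. x \<in> H \<Longrightarrow> x \<in> K \<or> x \<in> P \<or> inv x \<in> P"
    and mult: "\<And>x y. x \<in> P \<Longrightarrow> y \<in> P \<Longrightarrow> x \<otimes> y \<in> P"
      "\<And>x k. x \<in> P \<Longrightarrow> k \<in> K \<Longrightarrow> x \<otimes> k \<in> P" "\<And>x k. x \<in> P \<Longrightarrow> k \<in> K \<Longrightarrow> k \<otimes> x \<in> P"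
    using P by (auto simp: rel_cone_def)
  have c: "x \<in> H \<Longrightarrow> x \<in> carrier G" for x using H by (auto dest: subgroup.subset)
  have Pc: "x \<in> P \<Longrightarrow> x \<in> carrier G" and Kc: "x \<in> K \<Longrightarrow> x \<in> carrier G" for x using PH K c by auto
  have prod: "inv y \<otimes> inv x \<in> m_inv G ` P" if "x \<otimes> y \<in> P" "x \<in> carrier G" "y \<in> carrier G" for x y
    using that by (metis image_eqI inv_mult_group)
  have Kinv: "k \<in> K \<Longrightarrow> inv k \<in> K" for k using K by (simp add: subgroup.m_inv_closed)
  show ?thesis
    unfolding rel_cone_def
  proof (intro conjI ballI)
    show "m_inv G ` P \<subseteq> H"
      using PH H by (auto simp: subgroup.m_inv_closed)
    show "K \<inter> m_inv G ` P = {}"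
    proof -
      have "inv x \<notin> K" if "x \<in> P" for x
        using Kinv[of "inv x"] Pc[OF that] that KP by auto
      then show ?thesis by auto
    qed
    show "x \<in> K \<or> x \<in> m_inv G ` P \<or> inv x \<in> m_inv G ` P" if "x \<in> H" for x
      using total[OF that] c[OF that] by (metis image_eqI inv_inv)
    fix x assume "x \<in> m_inv G ` P"
    then obtain p where p: "p \<in> P" "x = inv p" by auto
    show "x \<otimes> y \<in> m_inv G ` P" if y: "y \<in> m_inv G ` P" for y
    proof -
      obtain q where q: "q \<in> P" "y = inv q" using y by auto
      show ?thesis using prod[of q p] mult(1)[of q p] p q Pc by simp
    qed
    fix k assume k: "k \<in> K"
    show "x \<otimes> k \<in> m_inv G ` P"
      using prod[of "inv k" p] mult(3)[of p "inv k"] p k Pc Kc Kinv by simp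
    show "k \<otimes> x \<in> m_inv G ` P"
      using prod[of p "inv k"] mult(2)[of p "inv k"] p k Pc Kc Kinv by simp
  qed (use H K in auto)
qed

lemma (in group) rel_cone_restrict:
  assumes P: "rel_cone G H K P" and J: "subgroup J G" "J \<subseteq> H"
  shows "rel_cone G J (J \<inter> K) (J \<inter> P)"
proof -
  have K: "subgroup K G" and KP: "K \<inter> P = {}"
    and total: "\<And>x. x \<in> H \<Longrightarrow> x \<in> K \<or> x \<in> P \<or> inv x \<in> P"
    and mult: "\<And>x y. x \<in> P \<Longrightarrow> y \<in> P \<Longrightarrow> x \<otimes> y \<in> P"
      "\<And>x k. x \<in> P \<Longrightarrow> k \<in> K \<Longrightarrow> x \<otimes> k \<in> P" "\<And>x k. x \<in> P \<Longrightarrow> k \<in> K \<Longrightarrow> k \<otimes> x \<in> P"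
    using P by (auto simp: rel_cone_def)
  have "subgroup (J \<inter> K) G" using J(1) K by (rule subgroups_Inter_pair)
  moreover have "x \<in> J \<Longrightarrow> x \<in> K \<or> x \<in> P \<or> inv x \<in> P" for x using total J(2) by blast
  moreover have "J \<inter> K \<inter> (J \<inter> P) = {}" using KP by blast
  ultimately show ?thesis
    unfolding rel_cone_def
    by (simp add: J(1) mult subgroup.m_closed[OF J(1)] subgroup.m_inv_closed[OF J(1)])
qed

text \<open>The last two assumptions say that H/K is torsion-free abelian, and such groups are
  orderable: a maximal partial cone is total, since it can only fail to be enlarged by
  \<open>x\<close> if a negative power of \<open>x\<close> already lies in it.\<close>

lemma (in group) rel_cone_abelian_quotient:
  assumes H: "subgroup H G" and K: "subgroup K G" "K \<subseteq> H"
    and abelian: "\<And>x y. x \<in> H \<Longrightarrow> y \<in> H \<Longrightarrow> comm x y \<in> K"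
    and torsion_free: "\<And>x n. x \<in> H \<Longrightarrow> n > 0 \<Longrightarrow> x [^] (n::nat) \<in> K \<Longrightarrow> x \<in> K"
  obtains P where "rel_cone G H K P"
proof -
  \<comment> \<open>Partial cones: the clauses of \<open>rel_cone\<close> on \<open>P\<close> except
    totality.\<close>
  define \<A> where "\<A> = {P. P \<subseteq> H \<and> K \<inter> P = {} \<and> (\<forall>x\<in>P. \<forall>y\<in>P. x \<otimes> y \<in> P) \<and>
     (\<forall>x\<in>P. \<forall>k\<in>K. x \<otimes> k \<in> P \<and> k \<otimes> x \<in> P)}"
  have "\<exists>M\<in>\<A>. \<forall>X\<in>\<A>. M \<subseteq> X \<longrightarrow> X = M"
  proof (rule subset_Zorn_nonempty)
    show "\<A> \<noteq> {}" by (auto simp: \<A>_def)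
    fix \<C> assume C: "\<C> \<noteq> {}" "subset.chain \<A> \<C>"
    have "x \<otimes> y \<in> \<Union>\<C>" if xy: "x \<in> \<Union>\<C>" "y \<in> \<Union>\<C>" for x y
    proof -
      obtain X Y where XY: "X \<in> \<C>" "x \<in> X" "Y \<in> \<C>" "y \<in> Y" using xy by blast
      then have "X \<subseteq> Y \<or> Y \<subseteq> X" using C(2) by (auto simp: subset_chain_def)
      then obtain X where X: "X \<in> \<C>" "x \<in> X" "y \<in> X" using XY by blast
      then have "X \<in> \<A>" using C(2) by (auto simp: subset_chain_def)
      then have "x \<otimes> y \<in> X" using X by (auto simp: \<A>_def)
      then show ?thesis using X(1) by blast
    qed
    moreover have "X \<subseteq> H" "K \<inter> X = {}" "\<And>x k. x \<in> X \<Longrightarrow> k \<in> K \<Longrightarrow> x \<otimes> k \<in> X \<and> k \<otimes> x \<in> X"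
      if "X \<in> \<C>" for X
      using C(2) that by (auto simp: subset_chain_def \<A>_def)
    ultimately show "\<Union>\<C> \<in> \<A>" unfolding \<A>_def mem_Collect_eq by (intro conjI) blast+
  qed
  then obtain M where M: "M \<in> \<A>" and max: "\<And>X. X \<in> \<A> \<Longrightarrow> M \<subseteq> X \<Longrightarrow> X = M"
    by blast
  have MH: "M \<subseteq> H" and MK: "K \<inter> M = {}"
    and MM: "x \<in> M \<Longrightarrow> y \<in> M \<Longrightarrow> x \<otimes> y \<in> M"
    and MKr: "x \<in> M \<Longrightarrow> k \<in> K \<Longrightarrow> x \<otimes> k \<in> M"
    and MKl: "x \<in> M \<Longrightarrow> k \<in> K \<Longrightarrow> k \<otimes> x \<in> M" for x y k
    using M by (auto simp: \<A>_def)
  have c [simp]: "x \<in> H \<Longrightarrow> x \<in> carrier G" for x using H by (auto dest: subgroup.subset)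
  have cK [simp]: "x \<in> K \<Longrightarrow> x \<in> carrier G" for x using K by auto
  have cM [simp]: "x \<in> M \<Longrightarrow> x \<in> carrier G" for x using MH by auto
  have KK: "x \<in> K \<Longrightarrow> y \<in> K \<Longrightarrow> x \<otimes> y \<in> K" for x y
    using K by (simp add: subgroup.m_closed)
  have powH: "x [^] (n::nat) \<in> H" if "x \<in> H" for x n
    using that H by (induction n) (auto simp: subgroup.one_closed subgroup.m_closed)
  have key: "\<exists>n::nat. inv (x [^] n) \<in> M \<and> n > 0" if x: "x \<in> H" "x \<notin> K" "x \<notin> M" for x
  proof -
    \<comment> \<open>What \<open>M\<close> becomes when \<open>x\<close> is adjoined. The last
      condition keeps out elements with \<open>u \<in> K\<close> and \<open>n = 0\<close>, which
      would be those of \<open>K\<close> itself.\<close>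
    define M' where
      "M' = {y. \<exists>(n::nat) u. y = u \<otimes> x [^] n \<and> u \<in> M \<union> K \<and> (u \<in> M \<or> n > 0)}"
    have assoc: "a \<otimes> (b \<otimes> c \<otimes> d) \<otimes> e = (a \<otimes> b \<otimes> c) \<otimes> (d \<otimes> e)"
      if "a \<in> carrier G" "b \<in> carrier G" "c \<in> carrier G" "d \<in> carrier G" "e \<in> carrier G" for a b c d e
      using that by (simp add: m_assoc)
    \<comment> \<open>Moving x^n past v costs a commutator, which lies in \<open>K\<close> and is
      absorbed.\<close>
    have prod: "(u \<otimes> x [^] n) \<otimes> (v \<otimes> x [^] m) = (u \<otimes> comm (x [^] n) v \<otimes> v) \<otimes> x [^] (n + m)"
      if "u \<in> H" "v \<in> H" for u v and n m :: nat
    proof -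
      have "(u \<otimes> x [^] n) \<otimes> (v \<otimes> x [^] m) = u \<otimes> (x [^] n \<otimes> v) \<otimes> x [^] m"
        using that x by (simp add: m_assoc)
      also have "\<dots> = u \<otimes> (comm (x [^] n) v \<otimes> v \<otimes> x [^] n) \<otimes> x [^] m"
        using that x by (subst mult_comm) auto
      also have "\<dots> = (u \<otimes> comm (x [^] n) v \<otimes> v) \<otimes> (x [^] n \<otimes> x [^] m)"
        using that x by (intro assoc) auto
      finally show ?thesis using x by (simp add: nat_pow_mult)
    qed
    have M'_mult: "(u \<otimes> x [^] n) \<otimes> (v \<otimes> x [^] m) \<in> M'"
      if uv: "u \<in> M \<union> K" "v \<in> M \<union> K" "u \<in> M \<or> v \<in> M \<or> n > 0 \<or> m > 0" for u v and n m :: nat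
    proof -
      have uvH: "u \<in> H" "v \<in> H" using uv MH K by auto
      have *: "comm (x [^] n) v \<in> K" using uvH x powH abelian by blast
      have "u \<otimes> comm (x [^] n) v \<otimes> v \<in> M \<union> K" "u \<in> M \<or> v \<in> M \<Longrightarrow> u \<otimes> comm (x [^] n) v \<otimes> v \<in> M"
        using uv(1,2) by (auto simp: * MM MKr MKl KK)
      then show ?thesis
        unfolding prod[OF uvH] M'_def mem_Collect_eq using uv(3)
        by (intro exI[of _ "n + m"] exI[of _ "u \<otimes> comm (x [^] n) v \<otimes> v"]) auto
    qed
    have sub: "M \<subseteq> M'"
    proof
      fix y assume "y \<in> M"
      then have "y = y \<otimes> x [^] (0::nat)" by simp
      then show "y \<in> M'" using \<open>y \<in> M\<close> unfolding M'_def by blast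
    qed
    have "\<one> \<otimes> x [^] (1::nat) \<in> M'"
      unfolding M'_def using subgroup.one_closed[OF K(1)] zero_less_one by blast
    then have "x \<in> M'" using x by simp
    then have "M' \<notin> \<A>" using max sub x(3) by blast
    moreover have "M' \<subseteq> H"
      using MH K powH[OF x(1)] by (auto simp: M'_def subsetD intro!: subgroup.m_closed[OF H])
    moreover have "\<forall>y\<in>M'. \<forall>z\<in>M'. y \<otimes> z \<in> M'"
    proof (intro ballI)
      fix y z assume "y \<in> M'" "z \<in> M'"
      then obtain n m :: nat and u v where "y = u \<otimes> x [^] n" "u \<in> M \<union> K" "u \<in> M \<or> n > 0"
        "z = v \<otimes> x [^] m" "v \<in> M \<union> K" unfolding M'_def by blast
      then show "y \<otimes> z \<in> M'" using M'_mult[of u v n m] by blast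
    qed
    moreover have "\<forall>y\<in>M'. \<forall>k\<in>K. y \<otimes> k \<in> M' \<and> k \<otimes> y \<in> M'"
    proof (intro ballI)
      fix y k assume "y \<in> M'" and k: "k \<in> K"
      then obtain n :: nat and u where *: "y = u \<otimes> x [^] n" "u \<in> M \<union> K" "u \<in> M \<or> n > 0"
        unfolding M'_def by blast
      have "k = k \<otimes> x [^] (0::nat)" using k by simp
      then show "y \<otimes> k \<in> M' \<and> k \<otimes> y \<in> M'"
        using * k M'_mult[of u k n 0] M'_mult[of k u 0 n] by auto
    qed
    ultimately have "K \<inter> M' \<noteq> {}" by (auto simp: \<A>_def)
    then obtain n :: nat and u where u: "u \<otimes> x [^] n \<in> K" "u \<in> M \<union> K" "u \<in> M \<or> n > 0"
      unfolding M'_def by blast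
    define k where "k = u \<otimes> x [^] n"
    have k: "k \<in> K" using u k_def by simp
    have uc: "u \<in> carrier G" using u by auto
    \<comment> \<open>With \<open>u\<close> in \<open>K\<close>, a positive power of
      \<open>x\<close>, hence \<open>x\<close> itself, would lie in \<open>K\<close>.\<close>
    have "u \<in> M"
    proof (rule ccontr)
      assume "u \<notin> M"
      then have "u \<in> K" "n > 0" using u by auto
      moreover have "x [^] n = inv u \<otimes> k" using k k_def uc x by (simp add: inv_solve_left)
      ultimately have "x [^] n \<in> K"
        using k K(1) by (simp add: subgroup.m_closed subgroup.m_inv_closed)
      then show False using torsion_free \<open>n > 0\<close> x by blast
    qed
    have "inv (x [^] n) = inv k \<otimes> u"
      using x uc unfolding k_def by (simp add: inv_mult_group m_assoc)
    then have "inv (x [^] n) \<in> M"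
      using MKl \<open>u \<in> M\<close> k K(1) by (simp add: subgroup.m_inv_closed)
    moreover have "n > 0"
    proof (rule ccontr)
      assume "\<not> n > 0"
      then have "\<one> \<in> M" using calculation by simp
      then show False using MK K(1) by (auto dest: subgroup.one_closed)
    qed
    ultimately show ?thesis by blast
  qed
  have powM: "y [^] (Suc m) \<in> M" if "y \<in> M" for y m
    using that MM by (induction m) auto
  \<comment> \<open>Applying \<open>key\<close> to \<open>x\<close> and to its inverse puts x^-n and
    x^m into \<open>M\<close>; suitable powers of these multiply to the identity, which
    \<open>M\<close> cannot contain.\<close>
  have "x \<in> K \<or> x \<in> M \<or> inv x \<in> M" if x: "x \<in> H" for x
  proof (rule ccontr)
    assume neg: "\<not> ?thesis"
    then obtain n where n: "inv (x [^] n) \<in> M" "n > (0::nat)" using key[of x] x by blast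
    have "inv x \<in> H" using x H by (simp add: subgroup.m_inv_closed)
    moreover have "inv x \<notin> K"
      using neg subgroup.m_inv_closed[OF K(1), of "inv x"] x by auto
    ultimately obtain m where m: "inv (inv x [^] m) \<in> M" "m > (0::nat)" using key[of "inv x"] neg by blast
    have "inv (inv x [^] m) = x [^] m" using x by (simp add: nat_pow_inv)
    then have "(x [^] m) [^] n \<in> M" using m n powM[of "x [^] m" "n - 1"] by simp
    moreover have "(inv (x [^] n)) [^] m \<in> M" using m n powM[of "inv (x [^] n)" "m - 1"] by simp
    ultimately have "(x [^] m) [^] n \<otimes> (inv (x [^] n)) [^] m \<in> M" using MM by blast
    moreover have "(x [^] m) [^] n \<otimes> (inv (x [^] n)) [^] m = \<one>"
      using x by (simp add: nat_pow_inv nat_pow_pow mult.commute)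
    ultimately show False using MK K(1) by (auto dest: subgroup.one_closed)
  qed
  then have "rel_cone G H K M"
    unfolding rel_cone_def by (simp add: H K MH MK MM MKr MKl)
  then show ?thesis by (rule that)
qed

text \<open>Order lexicographically along a well-ordering of the given quotients.\<close>

lemma (in group) rel_cone_residual:
  assumes "\<And>x. x \<in> carrier G \<Longrightarrow> x \<noteq> \<one> \<Longrightarrow> \<exists>K P. rel_cone G (carrier G) K P \<and> x \<notin> K"
  obtains P where "rel_cone G (carrier G) {\<one>} P"
proof -
  \<comment> \<open>Each non-identity element indexes a pair whose \<open>K\<close> omits that
    element, so every such element lies outside some \<open>K i\<close>.\<close>
  define I where "I = carrier G - {\<one>}"
  have "\<forall>i. \<exists>KP. i \<in> I \<longrightarrow> rel_cone G (carrier G) (fst KP) (snd KP) \<and> i \<notin> fst KP"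
    using assms by (auto simp: I_def)
  then obtain KP where *: "\<And>i. i \<in> I \<Longrightarrow> rel_cone G (carrier G) (fst (KP i)) (snd (KP i)) \<and> i \<notin> fst (KP i)"
    using choice[of "\<lambda>i KP. i \<in> I \<longrightarrow> rel_cone G (carrier G) (fst KP) (snd KP) \<and> i \<notin> fst KP"] by blast
  define K P where "K i = fst (KP i)" and "P i = snd (KP i)" for i
  have KP: "\<And>i. i \<in> I \<Longrightarrow> rel_cone G (carrier G) (K i) (P i)"
    and notin: "\<And>i. i \<in> I \<Longrightarrow> i \<notin> K i"
    unfolding K_def P_def using * by blast+
  obtain r :: "'a rel" where r: "Well_order r" "Field r = UNIV"
    using well_ordering[where 'a = 'a] by (elim exE conjE)
  define s where "s = r - Id"
  have wf: "wf s" using r by (simp add: s_def well_order_on_def)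
  have trans_s: "(i, k) \<in> s" if "(i, j) \<in> s" "(j, k) \<in> s" for i j k
    using that r unfolding s_def well_order_on_def linear_order_on_def partial_order_on_def preorder_on_def
    by (auto dest: transD antisymD)
  have total_s: "(i, j) \<in> s \<or> (j, i) \<in> s \<or> i = j" for i j
    using r unfolding s_def well_order_on_def linear_order_on_def total_on_def by auto
  have K: "subgroup (K i) G" and Psub: "P i \<subseteq> carrier G" and disj: "K i \<inter> P i = {}"
    and tot: "\<And>x. x \<in> carrier G \<Longrightarrow> x \<in> K i \<or> x \<in> P i \<or> inv x \<in> P i"
    and PP: "\<And>x y. x \<in> P i \<Longrightarrow> y \<in> P i \<Longrightarrow> x \<otimes> y \<in> P i"
    and PK: "\<And>x k. x \<in> P i \<Longrightarrow> k \<in> K i \<Longrightarrow> x \<otimes> k \<in> P i"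
    and KP': "\<And>x k. x \<in> P i \<Longrightarrow> k \<in> K i \<Longrightarrow> k \<otimes> x \<in> P i" if "i \<in> I" for i
    using KP[OF that] by (auto simp: rel_cone_def)
  \<comment> \<open>Membership in \<open>P i\<close> already excludes \<open>K i\<close>, so
    \<open>i\<close> is the least index at which \<open>x\<close> leaves \<open>K i\<close>.\<close>
  define Q where "Q = {x. \<exists>i\<in>I. x \<in> P i \<and> (\<forall>j\<in>I. (j, i) \<in> s \<longrightarrow> x \<in> K j)}"
  have "x = \<one> \<or> x \<in> Q \<or> inv x \<in> Q" if x: "x \<in> carrier G" for x
  proof (cases "x = \<one>")
    case False
    then have "x \<in> {i \<in> I. x \<notin> K i}" using x notin by (auto simp: I_def)
    then obtain i where i: "i \<in> I" "x \<notin> K i" and min: "\<And>j. (j, i) \<in> s \<Longrightarrow> j \<in> I \<Longrightarrow> x \<in> K j"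
      using wfE_min[OF wf] by (metis (no_types, lifting) mem_Collect_eq)
    have "x \<in> P i \<or> inv x \<in> P i" using tot[OF i(1) x] i by blast
    moreover have "inv x \<in> K j" if "(j, i) \<in> s" "j \<in> I" for j
      using min[OF that] K[OF that(2)] by (simp add: subgroup.m_inv_closed)
    ultimately show ?thesis using i(1) min unfolding Q_def by blast
  qed simp
  moreover have "x \<otimes> y \<in> Q" if "x \<in> Q" "y \<in> Q" for x y
  proof -
    obtain i where i: "i \<in> I" "x \<in> P i" "\<And>j. j \<in> I \<Longrightarrow> (j, i) \<in> s \<Longrightarrow> x \<in> K j"
      using \<open>x \<in> Q\<close> unfolding Q_def by blast
    obtain i' where i': "i' \<in> I" "y \<in> P i'" "\<And>j. j \<in> I \<Longrightarrow> (j, i') \<in> s \<Longrightarrow> y \<in> K j"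
      using \<open>y \<in> Q\<close> unfolding Q_def by blast
    \<comment> \<open>The smaller of the two indices: there one factor lies in \<open>P k\<close>
      and the other in \<open>P k\<close> or \<open>K k\<close>.\<close>
    obtain k where k: "k \<in> I" "x \<otimes> y \<in> P k" "k = i \<or> (k, i) \<in> s" "k = i' \<or> (k, i') \<in> s"
      using total_s[of i i'] i i' PP PK KP' by metis
    moreover have "x \<otimes> y \<in> K j" if "j \<in> I" "(j, k) \<in> s" for j
      using that k(3,4) i(3)[of j] i'(3)[of j] trans_s[of j k] K[of j] by (metis subgroup.m_closed)
    ultimately show ?thesis unfolding Q_def by blast
  qed
  moreover have "\<one> \<notin> Q"
    using subgroup.one_closed[OF K] disj by (fastforce simp: Q_def)
  moreover have Q: "Q \<subseteq> carrier G" using Psub by (auto simp: Q_def)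
  ultimately have "rel_cone G (carrier G) {\<one>} Q"
    by (auto simp: rel_cone_def triv_subgroup subgroup_self)
  then show ?thesis by (rule that)
qed

section \<open>The upper central series of a quotient\<close>

text \<open>The preimage in \<open>G\<close> of the upper central series of \<open>G/N\<close>.\<close>

primrec upper_central :: "('a, 'b) monoid_scheme \<Rightarrow> 'a set \<Rightarrow> nat \<Rightarrow> 'a set" where
  "upper_central G N 0 = N"
| "upper_central G N (Suc n) =
     {x \<in> carrier G. \<forall>y\<in>carrier G. x \<otimes>\<^bsub>G\<^esub> y \<otimes>\<^bsub>G\<^esub> inv\<^bsub>G\<^esub> x \<otimes>\<^bsub>G\<^esub> inv\<^bsub>G\<^esub> y \<in> upper_central G N n}"

lemma (in group) inv_cancel [simp]:
  assumes "x \<in> carrier G" "y \<in> carrier G"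
  shows "inv x \<otimes> (x \<otimes> y) = y" "x \<otimes> (inv x \<otimes> y) = y"
  using assms by (simp_all flip: m_assoc)

lemma (in group) comm_mult_left:
  assumes "x \<in> carrier G" "y \<in> carrier G" "z \<in> carrier G"
  shows "comm (x \<otimes> y) z = x \<otimes> comm y z \<otimes> inv x \<otimes> comm x z"
  using assms by (simp add: m_assoc inv_mult_group)

text \<open>Commutators of a product, an inverse or a conjugate expand into conjugates of
  commutators, or of their inverses, that lie in the previous term, so normality passes up the
  series.\<close>

lemma (in group) normal_upper_central:
  assumes "N \<lhd> G"
  shows "upper_central G N n \<lhd> G"
proof (induction n)
  case (Suc n)
  define Z where "Z = upper_central G N n"
  interpret Z: normal Z G using Suc by (simp add: Z_def)
  have Z': "upper_central G N (Suc n) = {x \<in> carrier G. \<forall>y\<in>carrier G. comm x y \<in> Z}"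
    by (simp add: Z_def)
  show ?case
    unfolding Z'
  proof (rule normal_invI)
    show "subgroup {x \<in> carrier G. \<forall>y\<in>carrier G. comm x y \<in> Z} G"
    proof (rule subgroup.intro, goal_cases)
      case (2 x y)
      have "comm (x \<otimes> y) z \<in> Z" if "z \<in> carrier G" for z
      proof -
        have *: "x \<in> carrier G" "y \<in> carrier G" "comm x z \<in> Z" "comm y z \<in> Z"
          using 2 that by auto
        show ?thesis
          unfolding comm_mult_left[OF *(1,2) that]
          by (rule Z.m_closed[OF Z.inv_op_closed2[OF *(1,4)] *(3)])
      qed
      then show ?case using 2 by simp
    next
      case (4 x)
      have "comm (inv x) y \<in> Z" if y: "y \<in> carrier G" for y
      proof -
        have "comm (inv x) y = inv x \<otimes> inv (comm x y) \<otimes> x"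
          using 4 y by (simp add: m_assoc inv_mult_group)
        then show ?thesis
          using 4 y Z.inv_op_closed1[OF _ Z.m_inv_closed, of x "comm x y"] by simp
      qed
      then show ?case using 4 by simp
    qed auto
    show "g \<otimes> x \<otimes> inv g \<in> {x \<in> carrier G. \<forall>y\<in>carrier G. comm x y \<in> Z}"
      if "g \<in> carrier G" "x \<in> {x \<in> carrier G. \<forall>y\<in>carrier G. comm x y \<in> Z}" for g x
    proof -
      have g: "g \<in> carrier G" and x: "x \<in> carrier G" "\<And>y. y \<in> carrier G \<Longrightarrow> comm x y \<in> Z"
        using that by auto
      have "comm (g \<otimes> x \<otimes> inv g) y \<in> Z" if y: "y \<in> carrier G" for y
      proof -
        have "comm (g \<otimes> x \<otimes> inv g) y = g \<otimes> comm x (inv g \<otimes> y \<otimes> g) \<otimes> inv g"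
          using g x(1) y by (simp add: m_assoc inv_mult_group)
        then show ?thesis
          using Z.inv_op_closed2[OF g x(2), of "inv g \<otimes> y \<otimes> g"] g y by simp
      qed
      then show ?thesis using g x(1) by simp
    qed
  qed
qed (simp add: assms)

text \<open>Normality suffices: [x, y] is the product of x and a conjugate of its inverse.\<close>

lemma (in group) upper_central_mono:
  assumes "N \<lhd> G" "m \<le> n"
  shows "upper_central G N m \<subseteq> upper_central G N n"
  using \<open>m \<le> n\<close>
proof (rule lift_Suc_mono_le[rotated])
  fix n
  interpret Z: normal "upper_central G N n" G using assms(1) by (rule normal_upper_central)
  have "comm x y \<in> upper_central G N n" if "x \<in> upper_central G N n" "y \<in> carrier G" for x y
  proof -
    have "comm x y = x \<otimes> (y \<otimes> inv x \<otimes> inv y)"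
      using that Z.mem_carrier by (simp add: m_assoc)
    then show ?thesis
      using that Z.inv_op_closed2 Z.m_closed Z.m_inv_closed by metis
  qed
  then show "upper_central G N n \<subseteq> upper_central G N (Suc n)"
    using Z.mem_carrier by auto
qed

lemma (in normal) rcos_eq_one_iff:
  assumes "x \<in> carrier G"
  shows "H #> x = \<one>\<^bsub>G Mod H\<^esub> \<longleftrightarrow> x \<in> H"
  using coset_join1[OF _ assms] coset_join2[OF assms] is_subgroup by (auto simp: FactGroup_def)

lemma (in normal) rcos_group_hom: "group_hom G (G Mod H) (\<lambda>x. H #> x)"
  by (simp add: group_hom_def group_hom_axioms_def r_coset_hom_Mod factorgroup_is_group is_group)

lemma (in group_hom) hom_comm:
  assumes "x \<in> carrier G" "y \<in> carrier G"
  shows "h (G.comm x y) = h x \<otimes>\<^bsub>H\<^esub> h y \<otimes>\<^bsub>H\<^esub> inv\<^bsub>H\<^esub> h x \<otimes>\<^bsub>H\<^esub> inv\<^bsub>H\<^esub> h y"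
  using assms by simp

lemma (in group) comm_eq_one_iff:
  assumes "x \<in> carrier G" "y \<in> carrier G"
  shows "comm x y = \<one> \<longleftrightarrow> x \<otimes> y = y \<otimes> x"
proof -
  have "comm x y = \<one> \<longleftrightarrow> x \<otimes> y \<otimes> inv x = y"
    using assms by (metis inv_equality inv_inv inv_closed m_closed r_inv)
  also have "\<dots> \<longleftrightarrow> x \<otimes> y = y \<otimes> x"
    using assms by (simp add: inv_solve_right')
  finally show ?thesis .
qed

section \<open>Torsion-freeness of the central factors\<close>

lemma (in group) comm_pow_left:
  fixes n :: nat
  assumes xy: "x \<in> carrier G" "y \<in> carrier G" and "comm x y \<otimes> x = x \<otimes> comm x y"
  shows "comm (x [^] n) y = comm x y [^] n"
proof (induction n)
  case (Suc n)
  have c: "comm x y \<in> carrier G" using xy by simp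
  have "x [^] n \<otimes> comm x y = comm x y \<otimes> x [^] n"
    using assms c group_commutes_pow[of x "comm x y" n] by simp
  \<comment> \<open>Conjugation by x^n, the correction in \<open>comm_mult_left\<close>, is harmless
    because it fixes [x, y].\<close>
  then have "x [^] n \<otimes> comm x y \<otimes> inv (x [^] n) = comm x y"
    using c xy(1) by (metis inv_solve_right' m_closed nat_pow_closed)
  then have "comm (x [^] Suc n) y = comm x y \<otimes> comm (x [^] n) y"
    using comm_mult_left[of "x [^] n" x y] xy by simp
  also have "\<dots> = comm x y [^] Suc n"
    using Suc nat_pow_Suc2[OF c] by simp
  finally show ?case .
qed (use xy in simp)

text \<open>The identity of \<open>comm_pow_left\<close> read in the image, so that [x, y] need
  commute with x only modulo the kernel.\<close>

lemma (in group_hom) comm_pow_in_kernel: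
  fixes n :: nat
  assumes xy: "x \<in> carrier G" "y \<in> carrier G"
    and "h (G.comm (G.comm x y) x) = \<one>\<^bsub>H\<^esub>" "h (G.comm (x [^] n) y) = \<one>\<^bsub>H\<^esub>"
  shows "h (G.comm x y [^] n) = \<one>\<^bsub>H\<^esub>"
proof -
  have "H.comm (h x) (h y) \<otimes>\<^bsub>H\<^esub> h x = h x \<otimes>\<^bsub>H\<^esub> H.comm (h x) (h y)"
    using assms(3) xy H.comm_eq_one_iff[of "H.comm (h x) (h y)" "h x"] by simp
  then have "H.comm (h x [^]\<^bsub>H\<^esub> n) (h y) = H.comm (h x) (h y) [^]\<^bsub>H\<^esub> n"
    using xy by (intro H.comm_pow_left) auto
  then show ?thesis
    using assms(4) xy by (simp add: hom_nat_pow)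
qed

text \<open>Exponents pass to commutators: for x in term k + 2 with x^n in term k + 1, the element
  [x, y] commutes with x modulo term k, so [x, y]^n is congruent to [x^n, y] and lies in term k. The
  induction hypothesis for [x, y] removes the exponent.\<close>

lemma (in group) upper_central_torsion_free:
  fixes n :: nat
  assumes N: "N \<lhd> G"
    and isolated: "\<And>x n. x \<in> carrier G \<Longrightarrow> n > 0 \<Longrightarrow> x [^] (n::nat) \<in> N \<Longrightarrow> x \<in> N"
    and "x \<in> upper_central G N (Suc k)" "n > 0" "x [^] n \<in> upper_central G N k"
  shows "x \<in> upper_central G N k"
  using assms(3-5)
proof (induction k arbitrary: x)
  case 0
  then show ?case using isolated[of x n] by simp
next
  case (Suc k)
  define Z where "Z = upper_central G N k"
  interpret Z: normal Z G unfolding Z_def using N by (rule normal_upper_central)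
  interpret q: group_hom G "G Mod Z" "\<lambda>x. Z #> x" by (rule Z.rcos_group_hom)
  have x: "x \<in> carrier G" using Suc.prems by simp
  have "comm x y \<in> Z" if y: "y \<in> carrier G" for y
  proof -
    have c: "comm x y \<in> carrier G" "comm x y \<in> upper_central G N (Suc k)"
      using Suc.prems x y by simp_all
    have "comm (comm x y) x \<in> Z" using c(2) x by (simp add: Z_def)
    moreover have "comm (x [^] n) y \<in> Z"
      using Suc.prems(3) y by (simp add: Z_def)
    ultimately have "comm x y [^] n \<in> Z"
      by (intro Z.rcos_eq_one_iff[THEN iffD1, OF _ q.comm_pow_in_kernel[OF x y
            Z.rcos_eq_one_iff[THEN iffD2] Z.rcos_eq_one_iff[THEN iffD2]]]) (simp_all add: x y)
    then show ?thesis
      using Suc.IH[OF c(2) \<open>n > 0\<close>] by (simp add: Z_def)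
  qed
  then show ?case using x by (simp add: Z_def)
qed

text \<open>Comparison of the two central series: by induction on \<open>i\<close>, the preimage of
  the lower term at \<open>c - i\<close> lies in the upper term at \<open>i\<close>. At
  \<open>i = c\<close> the lower term is the whole quotient.\<close>

lemma (in group) upper_central_eq_carrier:
  assumes N: "N \<lhd> G" and nilpotent: "lower_central (G Mod N) c = {\<one>\<^bsub>G Mod N\<^esub>}"
  shows "upper_central G N c = carrier G"
proof -
  interpret N: normal N G by fact
  interpret q: group_hom G "G Mod N" "\<lambda>x. N #> x" by (rule N.rcos_group_hom)
  have "x \<in> upper_central G N i"
    if "i \<le> c" "x \<in> carrier G" "N #> x \<in> lower_central (G Mod N) (c - i)" for i x
    using that
  proof (induction i arbitrary: x)
    case 0
    then show ?case using nilpotent N.rcos_eq_one_iff by simp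
  next
    case (Suc i)
    have "comm x y \<in> upper_central G N i" if y: "y \<in> carrier G" for y
    proof (rule Suc.IH)
      have "c - i = Suc (c - Suc i)" using Suc.prems by simp
      then show "N #> comm x y \<in> lower_central (G Mod N) (c - i)"
        using Suc.prems y q.hom_comm[of x y] by (auto intro!: generate.incl bexI simp del: q.hom_mult)
    qed (use Suc.prems y in auto)
    then show ?case using Suc.prems by simp
  qed
  from this[of c] have "carrier G \<subseteq> upper_central G N c" by (auto simp: q.hom_closed)
  moreover interpret Z: normal "upper_central G N c" G using N by (rule normal_upper_central)
  have "upper_central G N c \<subseteq> carrier G" by (rule Z.subset)
  ultimately show ?thesis by blast
qed

section \<open>Relatively convex subgroups from chains of subgroups\<close>

lemma (in group) rel_cone_chain:
  assumes "\<And>i. subgroup (L i) G" and "\<And>i. \<exists>P. rel_cone G (L (Suc i)) (L i) P"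
  shows "\<exists>P. rel_cone G (L n) (L 0) P"
proof (induction n)
  case 0
  then show ?case using assms(1) rel_cone_refl by blast
next
  case (Suc n)
  then show ?case using assms(2) rel_cone_trans by blast
qed

text \<open>The factors of the upper central series are torsion-free abelian, so each can be
  ordered, and the orders stack lexicographically from \<open>N\<close> up to G.\<close>

lemma (in group) rel_cone_nilpotent_quotient:
  assumes N: "N \<lhd> G"
    and isolated: "\<And>x n. x \<in> carrier G \<Longrightarrow> n > 0 \<Longrightarrow> x [^] (n::nat) \<in> N \<Longrightarrow> x \<in> N"
    and c: "upper_central G N c = carrier G"
  shows "\<exists>P. rel_cone G (carrier G) N P"
proof -
  have sub: "subgroup (upper_central G N i) G" for i
    using normal_upper_central[OF N] by (simp add: normal_imp_subgroup)
  have "\<exists>P. rel_cone G (upper_central G N (Suc i)) (upper_central G N i) P" for i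
  proof (rule rel_cone_abelian_quotient[OF sub sub])
    show "upper_central G N i \<subseteq> upper_central G N (Suc i)"
      by (rule upper_central_mono[OF N]) simp
    show "comm x y \<in> upper_central G N i"
      if "x \<in> upper_central G N (Suc i)" "y \<in> upper_central G N (Suc i)" for x y
      using that by simp
    show "x \<in> upper_central G N i"
      if "x \<in> upper_central G N (Suc i)" "0 < n" "x [^] n \<in> upper_central G N i" for x and n :: nat
      by (rule upper_central_torsion_free[OF N _ that]) (fact isolated)
  qed blast
  from rel_cone_chain[of "upper_central G N", OF sub this, of c] show ?thesis
    using c by simp
qed

text \<open>Since u and p commute modulo the kernel, p^n splits off. With p a power of g, this
  reduces the root condition for \<langle>g\<rangle>(A \<inter> Z i) to the one for the central
  series.\<close>

lemma (in group_hom) mult_pow_div_pow: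
  fixes n :: nat
  assumes "u \<in> carrier G" "p \<in> carrier G" "h (G.comm u p) = \<one>\<^bsub>H\<^esub>"
  shows "h ((u \<otimes> p) [^] n \<otimes> inv (p [^] n)) = h (u [^] n)"
proof -
  have "h u \<otimes>\<^bsub>H\<^esub> h p = h p \<otimes>\<^bsub>H\<^esub> h u"
    using assms H.comm_eq_one_iff[of "h u" "h p"] by simp
  then have "(h u \<otimes>\<^bsub>H\<^esub> h p) [^]\<^bsub>H\<^esub> n = h u [^]\<^bsub>H\<^esub> n \<otimes>\<^bsub>H\<^esub> h p [^]\<^bsub>H\<^esub> n"
    using assms by (intro H.pow_mult_distrib) auto
  then show ?thesis using assms by (simp add: hom_nat_pow H.m_assoc)
qed

lemma (in normal) mult_pow_div_pow:
  fixes n :: nat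
  assumes "u \<in> carrier G" "p \<in> carrier G" "comm u p \<in> H"
  shows "(u \<otimes> p) [^] n \<otimes> inv (p [^] n) \<in> H \<longleftrightarrow> u [^] n \<in> H"
proof -
  interpret q: group_hom G "G Mod H" "\<lambda>x. H #> x" by (rule rcos_group_hom)
  have "H #> ((u \<otimes> p) [^] n \<otimes> inv (p [^] n)) = H #> (u [^] n)"
    by (rule q.mult_pow_div_pow[OF assms(1,2) rcos_eq_one_iff[THEN iffD2]]) (simp_all add: assms)
  then show ?thesis
    using rcos_eq_one_iff[of "(u \<otimes> p) [^] n \<otimes> inv (p [^] n)"] rcos_eq_one_iff[of "u [^] n"] assms by auto
qed

text \<open>With \<open>Z i\<close> the upper central series over \<open>N\<close> and \<open>A = ker f\<close>, the subgroups
  \<open>L i = \<langle>g\<rangle>(A \<inter> Z i)\<close> form a chain ending in \<open>G\<close> whose factors are torsion-free abelian because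
  \<open>\<langle>g\<rangle> \<inter> A = 1\<close>.\<close>

lemma (in group) rel_cone_cyclic_extension:
  assumes N: "N \<lhd> G"
    and isolated: "\<And>x n. x \<in> carrier G \<Longrightarrow> n > 0 \<Longrightarrow> x [^] (n::nat) \<in> N \<Longrightarrow> x \<in> N"
    and c: "upper_central G N c = carrier G"
    and f: "f \<in> hom G integer_group" and g: "g \<in> carrier G" "f g = 1"
  shows "\<exists>P. rel_cone G (carrier G) {x \<in> carrier G. x \<otimes> inv (g [^] f x) \<in> N} P"
proof -
  interpret f: group_hom G integer_group f
    by (simp add: group_hom_def group_hom_axioms_def f)
  \<comment> \<open>The component of \<open>x\<close> in ker f: as f g = 1, \<open>w x\<close> has
    degree 0.\<close>
  define w where "w x = x \<otimes> inv (g [^] f x)" for x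
  define Z where "Z = upper_central G N"
  define L where "L i = {x \<in> carrier G. w x \<in> Z i}" for i
  have normalZ: "Z i \<lhd> G" for i using N normal_upper_central by (simp add: Z_def)
  have wc [simp]: "x \<in> carrier G \<Longrightarrow> w x \<in> carrier G" for x using g by (simp add: w_def)
  have w_decomp: "x = w x \<otimes> g [^] f x" if "x \<in> carrier G" for x
    using that g by (simp add: w_def m_assoc)
  have Z_Suc: "comm x y \<in> Z i" if "x \<in> Z (Suc i)" "y \<in> carrier G" for x y i
    using that by (simp add: Z_def)
  have sub: "subgroup (L i) G" for i
  proof -
    interpret Z: normal "Z i" G by (rule normalZ)
    show ?thesis
    proof (rule subgroup.intro, goal_cases)
      case (2 x y)
      then have xy: "x \<in> carrier G" "y \<in> carrier G" "w x \<in> Z i" "w y \<in> Z i" by (auto simp: L_def)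
      \<comment> \<open>\<open>w\<close> is multiplicative only up to a conjugation, which normality
        of \<open>Z i\<close> absorbs.\<close>
      have "w (x \<otimes> y) = x \<otimes> w y \<otimes> inv x \<otimes> w x"
      proof -
        have "w (x \<otimes> y) = x \<otimes> y \<otimes> inv (g [^] (f x + f y))"
          using xy by (simp add: w_def)
        also have "\<dots> = x \<otimes> w y \<otimes> inv x \<otimes> w x"
          using xy g by (simp only: int_pow_mult) (simp add: w_def m_assoc inv_mult_group)
        finally show ?thesis .
      qed
      then show ?case using xy Z.inv_op_closed2[of x "w y"] by (simp add: L_def Z.m_closed)
    next
      case (4 x)
      then have x: "x \<in> carrier G" "w x \<in> Z i" by (auto simp: L_def)
      have "w (inv x) = inv x \<otimes> inv (w x) \<otimes> x"
        using x g by (simp add: w_def inv_mult_group int_pow_neg m_assoc)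
      then show ?case using x Z.inv_op_closed1[of x "inv (w x)"] by (simp add: L_def)
    qed (use g in \<open>auto simp: L_def w_def\<close>)
  qed
  have "\<exists>P. rel_cone G (L (Suc i)) (L i) P" for i
  proof (rule rel_cone_abelian_quotient[OF sub sub])
    interpret Z: normal "Z i" G by (rule normalZ)
    show "L i \<subseteq> L (Suc i)"
      using upper_central_mono[OF N, of i "Suc i"] unfolding L_def Z_def by auto
    show "comm x y \<in> L i" if "x \<in> L (Suc i)" "y \<in> L (Suc i)" for x y
    proof -
      \<comment> \<open>Powers of g commute, so the expansion of [x, y] contains only conjugates of
        commutators with an entry in \<open>Z (Suc i)\<close>, and these lie in \<open>Z i\<close>.
        As [x, y] has degree 0, \<open>w\<close> fixes it.\<close>
      define p r where "p = g [^] f x" and "r = g [^] f y"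
      have xy: "x \<in> carrier G" "y \<in> carrier G" "w x \<in> Z (Suc i)" "w y \<in> Z (Suc i)"
        using that by (auto simp: L_def)
      have pr: "p \<in> carrier G" "r \<in> carrier G" using g by (auto simp: p_def r_def)
      have "r \<otimes> p = p \<otimes> r"
        using g by (simp add: p_def r_def add.commute flip: int_pow_mult)
      then have "comm r p = \<one>" by (rule comm_eq_one_iff[OF pr(2,1), THEN iffD2])
      then have "comm y p = w y \<otimes> \<one> \<otimes> inv (w y) \<otimes> comm (w y) p"
        using comm_mult_left[of "w y" r p] w_decomp[of y] xy pr by (simp add: r_def)
      then have "comm y p \<in> Z i" using Z_Suc xy pr by simp
      moreover have "comm p y = inv (comm y p)"
        using xy pr by (simp add: inv_mult_group m_assoc)
      ultimately have "comm p y \<in> Z i" by (simp only: Z.m_inv_closed)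
      then have "w x \<otimes> comm p y \<otimes> inv (w x) \<otimes> comm (w x) y \<in> Z i"
        by (rule Z.m_closed[OF Z.inv_op_closed2[OF wc[OF xy(1)]] Z_Suc[OF xy(3,2)]])
      moreover have "comm x y = w x \<otimes> comm p y \<otimes> inv (w x) \<otimes> comm (w x) y"
        using comm_mult_left[of "w x" p y] w_decomp[of x] xy pr by (simp add: p_def)
      moreover have "w (comm x y) = comm x y" using xy g by (simp add: w_def)
      ultimately show ?thesis using xy by (simp add: L_def)
    qed
    show "x \<in> L i" if "x \<in> L (Suc i)" "0 < n" "x [^] n \<in> L i" for x and n :: nat
    proof -
      define p where "p = g [^] f x"
      have x: "x \<in> carrier G" "w x \<in> Z (Suc i)" and p: "p \<in> carrier G"
        using that g by (auto simp: L_def p_def)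
      \<comment> \<open>The degree of x^n is n f x, so w (x^n) is (w x p)^n p^-n, which is congruent
        to (w x)^n modulo \<open>Z i\<close>.\<close>
      have "g [^] f (x [^] n) = p [^] n"
        using x g int_pow_pow[OF g(1), of "f x" "int n"]
        by (simp add: p_def f.hom_nat_pow int_pow_int mult.commute)
      then have "(w x \<otimes> p) [^] n \<otimes> inv (p [^] n) \<in> Z i"
        using that(3) w_decomp[of x] x by (simp add: L_def w_def[of "x [^] n"] p_def)
      then have "w x [^] n \<in> Z i"
        using Z.mult_pow_div_pow[of "w x" p n] Z_Suc x p by simp
      then have "w x \<in> Z i"
        using upper_central_torsion_free[OF N _ x(2)[unfolded Z_def] \<open>0 < n\<close>] isolated
        unfolding Z_def by blast
      then show ?thesis using x by (simp add: L_def)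
    qed
  qed blast
  from rel_cone_chain[of L, OF sub this, of c] show ?thesis
    using c by (simp add: L_def Z_def w_def[abs_def] g cong: conj_cong)
qed

section \<open>Homomorphisms onto the integers\<close>

lemma (in comm_group) generate_insert_decomp:
  assumes S: "S \<subseteq> carrier G" "s \<in> carrier G" and x: "x \<in> generate G (insert s S)"
  obtains y and k :: int where "y \<in> generate G S" "x = y \<otimes> s [^] k"
proof -
  have c: "y \<in> generate G S \<Longrightarrow> y \<in> carrier G" for y using S generate_in_carrier by blast
  have "\<exists>y (k::int). y \<in> generate G S \<and> x = y \<otimes> s [^] k"
    using x
  proof (induction rule: generate.induct)
    case one
    then show ?case using generate.one[of G S] by (intro exI[of _ \<one>] exI[of _ 0]) auto
  next
    case (incl h)
    then show ?case
    proof (cases "h = s")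
      case True
      then show ?thesis using S generate.one[of G S] by (intro exI[of _ \<one>] exI[of _ 1]) auto
    next
      case False
      then show ?thesis using incl S generate.incl[of h S G] by (intro exI[of _ h] exI[of _ 0]) auto
    qed
  next
    case (inv h)
    then show ?case
    proof (cases "h = s")
      case True
      then show ?thesis
        using S generate.one[of G S] by (intro exI[of _ \<one>] exI[of _ "-1"]) (auto simp: int_pow_neg)
    next
      case False
      then show ?thesis using inv S generate.inv[of h S G] by (intro exI[of _ "inv h"] exI[of _ 0]) auto
    qed
  next
    case (eng h1 h2)
    then obtain y1 y2 and k1 k2 :: int where
      "y1 \<in> generate G S" "h1 = y1 \<otimes> s [^] k1" "y2 \<in> generate G S" "h2 = y2 \<otimes> s [^] k2"
      by blast
    then show ?case
      using c S(2) generate.eng[of y1 G S y2]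
      by (intro exI[of _ "y1 \<otimes> y2"] exI[of _ "k1 + k2"]) (simp add: int_pow_mult m_ac)
  qed
  then show ?thesis using that by blast
qed

text \<open>Induction on the generators stands in for the structure theorem. If a positive power of
  the new generator \<open>s\<close> lies in the old subgroup, a map is carried over by taking
  powers; otherwise the new subgroup is the direct product of the old one with \<langle>s\<rangle>,
  and the exponent of \<open>s\<close> is the map.\<close>

lemma (in comm_group) ex_int_hom_generate:
  assumes torsion_free: "\<And>x n. x \<in> carrier G \<Longrightarrow> n > 0 \<Longrightarrow> x [^] (n::nat) = \<one> \<Longrightarrow> x = \<one>"
    and "finite S" "S \<subseteq> carrier G" "generate G S \<noteq> {\<one>}"
  shows "\<exists>f::'a \<Rightarrow> int. (\<forall>x\<in>generate G S. \<forall>y\<in>generate G S. f (x \<otimes> y) = f x + f y) \<and>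
           (\<exists>x\<in>generate G S. f x \<noteq> 0)"
  using assms(2-4)
proof (induction S rule: finite_induct)
  case empty
  then show ?case by (simp add: generate_empty)
next
  case (insert s S)
  define A B where "A = generate G S" and "B = generate G (insert s S)"
  have s: "s \<in> carrier G" and S: "S \<subseteq> carrier G" using insert.prems by auto
  have subA: "subgroup A G" and subB: "subgroup B G"
    unfolding A_def B_def using insert.prems by (intro generate_is_subgroup; simp)+
  interpret A: subgroup A G by (rule subA)
  interpret B: subgroup B G by (rule subB)
  have AB: "A \<subseteq> B" unfolding A_def B_def by (rule mono_generate) blast
  have sB: "s \<in> B" unfolding B_def by (rule generate.incl) simp
  have decomp: "\<exists>y (k::int). y \<in> A \<and> x = y \<otimes> s [^] k" if "x \<in> B" for x
    using generate_insert_decomp[OF S s that[unfolded B_def]] unfolding A_def by blast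
  show ?case
  proof (cases "\<exists>n>0. s [^] (n::nat) \<in> A")
    case True
    then obtain n :: nat where n: "n > 0" "s [^] n \<in> A" by blast
    have "A \<noteq> {\<one>}"
    proof
      assume A1: "A = {\<one>}"
      then have "s = \<one>" using torsion_free[OF s n(1)] n(2) by simp
      have "x = \<one>" if x: "x \<in> B" for x
        using decomp[OF x] unfolding A1 \<open>s = \<one>\<close> by auto
      then have "B = {\<one>}" using B.one_closed by blast
      then show False using insert.prems by (simp add: B_def)
    qed
    then obtain f :: "'a \<Rightarrow> int" and z where f: "\<And>x y. x \<in> A \<Longrightarrow> y \<in> A \<Longrightarrow> f (x \<otimes> y) = f x + f y"
      and z: "z \<in> A" "f z \<noteq> 0"
      using insert.IH[OF S] unfolding A_def by blast
    \<comment> \<open>The n-th power map is a homomorphism from \<open>B\<close> into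
      \<open>A\<close>; composing f with it extends n f to \<open>B\<close> without any
      division.\<close>
    have powA: "x [^] n \<in> A" if x: "x \<in> B" for x
    proof -
      obtain y and k :: int where yk: "y \<in> A" "x = y \<otimes> s [^] k" using decomp[OF x] by blast
      have "(s [^] k) [^] n = (s [^] n) [^] k"
        using s by (simp add: int_pow_pow mult.commute flip: int_pow_int)
      then have "x [^] n = y [^] n \<otimes> (s [^] n) [^] k"
        using yk s by (simp add: nat_pow_distrib)
      then show ?thesis
        using yk n s subgroup_int_pow_closed[OF subA, of "s [^] n" k]
          subgroup_int_pow_closed[OF subA, of y "int n"] by (simp add: int_pow_int)
    qed
    have "f \<one> = 0" using f[of \<one> \<one>] by simp
    have "z [^] m \<in> A \<and> f (z [^] m) = int m * f z" for m :: nat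
      using z(1) f \<open>f \<one> = 0\<close> by (induction m) (simp_all add: algebra_simps)
    then have "f (z [^] n) \<noteq> 0" using n z by simp
    moreover have "f ((x \<otimes> y) [^] n) = f (x [^] n) + f (y [^] n)" if "x \<in> B" "y \<in> B" for x y
      using that f powA by (simp add: nat_pow_distrib)
    ultimately show ?thesis
      unfolding B_def[symmetric] using z AB by (intro exI[of _ "\<lambda>x. f (x [^] n)"]) auto
  next
    case False
    have s_pow: "k = 0" if "s [^] k \<in> A" for k :: int
    proof (rule ccontr)
      assume "k \<noteq> 0"
      moreover have "s [^] \<bar>k\<bar> \<in> A"
        using that A.m_inv_closed[OF that] s by (simp add: abs_if int_pow_neg)
      ultimately show False
        using False s by (metis abs_ge_zero int_pow_int zero_less_abs_iff zero_less_nat_eq nat_0_le)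
    qed
    \<comment> \<open>The exponent is unique because no non-zero power of \<open>s\<close> lies in
      \<open>A\<close>.\<close>
    define f where "f x = (THE k::int. x \<otimes> s [^] (- k) \<in> A)" for x
    have f_eq: "f (y \<otimes> s [^] k) = k" if "y \<in> A" for y k
    proof -
      have yc: "y \<in> carrier G" using that by simp
      have "(y \<otimes> s [^] k) \<otimes> s [^] (- l) = y \<otimes> s [^] (k - l)" for l
        using yc s by (simp add: m_assoc flip: int_pow_mult)
      moreover have "y \<otimes> s [^] (k - l) \<in> A \<longleftrightarrow> l = k" for l
      proof
        assume "y \<otimes> s [^] (k - l) \<in> A"
        then have "inv y \<otimes> (y \<otimes> s [^] (k - l)) \<in> A" using that by simp
        then show "l = k" using s_pow[of "k - l"] yc s by simp
      qed (use that in simp)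
      ultimately have "y \<otimes> s [^] k \<otimes> s [^] (- l) \<in> A \<longleftrightarrow> l = k" for l by presburger
      then show ?thesis unfolding f_def by (intro the_equality) blast+
    qed
    have "f (x \<otimes> y) = f x + f y" if xy: "x \<in> B" "y \<in> B" for x y
    proof -
      obtain u v and k l :: int where uv: "u \<in> A" "x = u \<otimes> s [^] k" "v \<in> A" "y = v \<otimes> s [^] l"
        using decomp[OF xy(1)] decomp[OF xy(2)] by blast
      then have "x \<otimes> y = (u \<otimes> v) \<otimes> s [^] (k + l)" using s by (simp add: int_pow_mult m_ac)
      then show ?thesis using uv f_eq by simp
    qed
    moreover have "f s \<noteq> 0" using f_eq[of \<one> 1] s by simp
    ultimately show ?thesis unfolding B_def[symmetric] using sB by blast
  qed
qed

text \<open>The least positive value \<open>d\<close> divides every value, so dividing by it makes 1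
  a value and keeps the zeros.\<close>

lemma (in group) int_hom_normalize:
  assumes "\<And>x y. x \<in> carrier G \<Longrightarrow> y \<in> carrier G \<Longrightarrow> f (x \<otimes> y) = (f x + f y :: int)"
    and "x0 \<in> carrier G" "f x0 \<noteq> 0"
  shows "\<exists>f'\<in>hom G integer_group. (\<exists>g\<in>carrier G. f' g = 1) \<and> (\<forall>x\<in>carrier G. f x = 0 \<longrightarrow> f' x = 0)"
proof -
  interpret f: group_hom G integer_group f
    by (simp add: group_hom_def group_hom_axioms_def hom_def assms)
  define d where "d = (LEAST n. n > 0 \<and> (\<exists>x\<in>carrier G. f x = int n))"
  have "\<exists>n>0. \<exists>x\<in>carrier G. f x = int n"
  proof (cases "f x0 > 0")
    case True
    then show ?thesis using assms by (intro exI[of _ "nat (f x0)"]) auto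
  next
    case False
    then have "f (inv x0) = int (nat (- f x0))" using assms by simp
    then show ?thesis using assms False by (intro exI[of _ "nat (- f x0)"]) (auto intro!: bexI[of _ "inv x0"])
  qed
  then have "d > 0 \<and> (\<exists>x\<in>carrier G. f x = int d)"
    unfolding d_def by (rule LeastI_ex)
  then obtain g where d: "d > 0" and g: "g \<in> carrier G" "f g = int d" by blast
  have min: "d \<le> n" if "n > 0" "x \<in> carrier G" "f x = int n" for n x
    unfolding d_def using that by (intro Least_le) auto
  have dvd: "int d dvd f x" if x: "x \<in> carrier G" for x
  proof -
    \<comment> \<open>An element whose value is the remainder of \<open>f x\<close> modulo
      \<open>d\<close>; minimality of \<open>d\<close> forces that remainder to be 0.\<close>
    define y where "y = x \<otimes> inv (g [^] (f x div int d))"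
    have y: "y \<in> carrier G" "f y = f x mod int d"
      using x g by (auto simp: y_def f.hom_int_pow minus_div_mult_eq_mod)
    have "nat (f y) = 0"
    proof (rule ccontr)
      assume "nat (f y) \<noteq> 0"
      then have "d \<le> nat (f y)" using min[of "nat (f y)" y] y(1) by auto
      then show False using y d pos_mod_bound[of "int d" "f x"] by linarith
    qed
    then have "f x mod int d = 0" using y d pos_mod_sign[of "int d" "f x"] by linarith
    then show ?thesis by (simp add: dvd_eq_mod_eq_0)
  qed
  have "(\<lambda>x. f x div int d) \<in> hom G integer_group"
    using assms(1) dvd by (auto simp: hom_def div_plus_div_distrib_dvd_left)
  moreover have "f g div int d = 1" using g d by simp
  ultimately show ?thesis using g(1) by (intro bexI[of _ "\<lambda>x. f x div int d"]) auto
qed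

text \<open>Commutativity and torsion-freeness are asked of the image alone, because the target will
  be \<open>G Mod N\<close>, which need not be abelian.\<close>

lemma (in group_hom) ex_int_hom_abelian_image:
  assumes S: "finite S" "S \<subseteq> carrier G" "generate G S = carrier G"
    and comm: "\<And>x y. x \<in> carrier G \<Longrightarrow> y \<in> carrier G \<Longrightarrow> h x \<otimes>\<^bsub>H\<^esub> h y = h y \<otimes>\<^bsub>H\<^esub> h x"
    and torsion_free: "\<And>x n. x \<in> carrier G \<Longrightarrow> n > 0 \<Longrightarrow> h x [^]\<^bsub>H\<^esub> (n::nat) = \<one>\<^bsub>H\<^esub> \<Longrightarrow> h x = \<one>\<^bsub>H\<^esub>"
    and nontrivial: "x0 \<in> carrier G" "h x0 \<noteq> \<one>\<^bsub>H\<^esub>"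
  shows "\<exists>f\<in>hom G integer_group. (\<exists>g\<in>carrier G. f g = 1) \<and>
           (\<forall>x\<in>carrier G. h x = \<one>\<^bsub>H\<^esub> \<longrightarrow> f x = 0)"
proof -
  define A where "A = H\<lparr>carrier := h ` carrier G\<rparr>"
  have sub: "subgroup (h ` carrier G) H" by (rule img_is_subgroup)
  have "group A" unfolding A_def by (rule H.subgroup_imp_group[OF sub])
  then interpret A: comm_group A
    by (rule group.group_comm_groupI) (auto simp: A_def comm)
  have gen: "generate A (h ` S) = h ` carrier G"
    unfolding A_def using S(2) sub H.generate_consistent[of "h ` S" "h ` carrier G"] generate_img[OF S(2)] S(3)
    by (simp add: image_mono)
  have pow: "x [^]\<^bsub>A\<^esub> (n::nat) = x [^]\<^bsub>H\<^esub> n" for x n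
    by (simp add: A_def flip: H.nat_pow_consistent)
  have "\<exists>f::'c \<Rightarrow> int. (\<forall>x\<in>generate A (h ` S). \<forall>y\<in>generate A (h ` S). f (x \<otimes>\<^bsub>A\<^esub> y) = f x + f y) \<and>
           (\<exists>x\<in>generate A (h ` S). f x \<noteq> 0)"
  proof (rule A.ex_int_hom_generate)
    show "x = \<one>\<^bsub>A\<^esub>" if "x \<in> carrier A" "0 < n" "x [^]\<^bsub>A\<^esub> n = \<one>\<^bsub>A\<^esub>" for x and n :: nat
      using that torsion_free unfolding pow by (auto simp: A_def)
    show "generate A (h ` S) \<noteq> {\<one>\<^bsub>A\<^esub>}"
      unfolding gen using nontrivial by (auto simp: A_def)
  qed (use S in \<open>auto simp: A_def\<close>)
  then obtain f :: "'c \<Rightarrow> int" and z where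
    f: "\<And>x y. x \<in> carrier G \<Longrightarrow> y \<in> carrier G \<Longrightarrow> f (h x \<otimes>\<^bsub>H\<^esub> h y) = f (h x) + f (h y)"
    and z: "z \<in> carrier G" "f (h z) \<noteq> 0"
    unfolding gen by (auto simp: A_def)
  have "f \<one>\<^bsub>H\<^esub> = 0" using f[of "\<one>" "\<one>"] by simp
  then show ?thesis
    using G.int_hom_normalize[of "\<lambda>x. f (h x)" z] f z by (auto intro!: bexI)
qed

text \<open>In [y z, x] = y [z, x] y^-1 [y, x] the conjugation disappears, since commutators with x
  become central in the image.\<close>

lemma (in group_hom) group_hom_comm:
  assumes x: "x \<in> carrier G"
    and central: "\<And>y z. y \<in> carrier G \<Longrightarrow> z \<in> carrier G \<Longrightarrow> h (G.comm (G.comm y x) z) = \<one>\<^bsub>H\<^esub>"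
  shows "group_hom G H (\<lambda>y. h (G.comm y x))"
proof -
  have "h (G.comm (y \<otimes> z) x) = h (G.comm y x) \<otimes>\<^bsub>H\<^esub> h (G.comm z x)"
    if y: "y \<in> carrier G" and z: "z \<in> carrier G" for y z
  proof -
    define a b where "a = G.comm y x" and "b = G.comm z x"
    have ab: "a \<in> carrier G" "b \<in> carrier G" using x y z by (simp_all add: a_def b_def)
    have commute: "h b \<otimes>\<^bsub>H\<^esub> h c = h c \<otimes>\<^bsub>H\<^esub> h b" if "c \<in> carrier G" for c
      using central[OF z that] ab that H.comm_eq_one_iff[of "h b" "h c"] by (simp flip: b_def)
    have "G.comm (y \<otimes> z) x = y \<otimes> b \<otimes> inv y \<otimes> a"
      using G.comm_mult_left[OF y z x] by (simp only: a_def b_def)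
    then have "h (G.comm (y \<otimes> z) x) = h y \<otimes>\<^bsub>H\<^esub> h b \<otimes>\<^bsub>H\<^esub> inv\<^bsub>H\<^esub> h y \<otimes>\<^bsub>H\<^esub> h a"
      using y ab by simp
    also have "\<dots> = h b \<otimes>\<^bsub>H\<^esub> h a"
      using y ab commute[OF y, symmetric] by (simp add: H.m_assoc)
    also have "\<dots> = h a \<otimes>\<^bsub>H\<^esub> h b" using commute[OF ab(1)] .
    finally show ?thesis by (simp only: a_def b_def)
  qed
  then show ?thesis
    using x by (simp add: group_hom_def group_hom_axioms_def hom_def)
qed

lemma (in group) comm_upper_central:
  "x \<in> upper_central G N (Suc n) \<Longrightarrow> y \<in> carrier G \<Longrightarrow> comm x y \<in> upper_central G N n"
  by simp

text \<open>Each term depends monotonically on the preceding one, so a stall after the first term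
  persists.\<close>

lemma (in group) upper_central_stable:
  assumes "upper_central G N (Suc (Suc 0)) \<subseteq> upper_central G N (Suc 0)"
  shows "upper_central G N (Suc n) \<subseteq> upper_central G N (Suc 0)"
proof -
  have "upper_central G N (Suc (Suc n)) \<subseteq> upper_central G N (Suc n)" for n
  proof (induction n)
    case 0
    then show ?case using assms by simp
  next
    case (Suc n)
    then show ?case by auto
  qed
  then show ?thesis
    by (induction n) blast+
qed

text \<open>A non-trivial homomorphism with torsion-free abelian image is the projection to \<open>G/N\<close> if that
  is abelian, and otherwise \<open>y \<mapsto> [y, x]\<close> for some \<open>x\<close> in
  the second but not the first term of the upper central series.\<close>

lemma (in group) ex_int_hom_nilpotent_quotient:
  assumes S: "finite S" "S \<subseteq> carrier G" "generate G S = carrier G"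
    and N: "N \<lhd> G" "N \<noteq> carrier G"
    and isolated: "\<And>x n. x \<in> carrier G \<Longrightarrow> n > 0 \<Longrightarrow> x [^] (n::nat) \<in> N \<Longrightarrow> x \<in> N"
    and c: "upper_central G N c = carrier G"
  shows "\<exists>f\<in>hom G integer_group. (\<exists>g\<in>carrier G. f g = 1) \<and> (\<forall>x\<in>N. f x = 0)"
proof -
  interpret N: normal N G by fact
  interpret q: group_hom G "G Mod N" "\<lambda>x. N #> x" by (rule N.rcos_group_hom)
  note q_one = N.rcos_eq_one_iff
  have tf: "N #> x = \<one>\<^bsub>G Mod N\<^esub>"
    if "x \<in> carrier G" "n > 0" "(N #> x) [^]\<^bsub>G Mod N\<^esub> n = \<one>\<^bsub>G Mod N\<^esub>" for x and n :: nat
    using that isolated[of x n] q_one[of x] q_one[of "x [^] n"] q.hom_nat_pow[of x n] by (simp del: one_FactGroup)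
  have q_comm: "(N #> x) \<otimes>\<^bsub>G Mod N\<^esub> (N #> y) = (N #> y) \<otimes>\<^bsub>G Mod N\<^esub> (N #> x)"
    if "x \<in> carrier G" "y \<in> carrier G" "comm x y \<in> N" for x y
    using that q_one[of "comm x y"] q.H.comm_eq_one_iff[of "N #> x" "N #> y"]
    by (simp del: one_FactGroup mult_FactGroup)
  show ?thesis
  proof (cases "upper_central G N 1 = carrier G")
    case True
    then have abelian: "comm x y \<in> N" if "x \<in> carrier G" "y \<in> carrier G" for x y
      using that by auto
    obtain x0 where x0: "x0 \<in> carrier G" "x0 \<notin> N" using N(2) N.subset by blast
    have "\<exists>f\<in>hom G integer_group. (\<exists>g\<in>carrier G. f g = 1) \<and>
           (\<forall>x\<in>carrier G. N #> x = \<one>\<^bsub>G Mod N\<^esub> \<longrightarrow> f x = 0)"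
    proof (rule q.ex_int_hom_abelian_image[OF S])
      show "(N #> x) \<otimes>\<^bsub>G Mod N\<^esub> (N #> y) = (N #> y) \<otimes>\<^bsub>G Mod N\<^esub> (N #> x)"
        if "x \<in> carrier G" "y \<in> carrier G" for x y
        by (rule q_comm[OF that abelian[OF that]])
      show "N #> x = \<one>\<^bsub>G Mod N\<^esub>"
        if "x \<in> carrier G" "0 < n" "(N #> x) [^]\<^bsub>G Mod N\<^esub> n = \<one>\<^bsub>G Mod N\<^esub>" for x and n :: nat
        by (rule tf[OF that])
      show "N #> x0 \<noteq> \<one>\<^bsub>G Mod N\<^esub>" unfolding q_one[OF x0(1)] by (rule x0)
    qed (rule x0)
    then show ?thesis
      by (rule bexE) (rule bexI, auto simp: q_one N.mem_carrier simp del: one_FactGroup)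
  next
    case False
    \<comment> \<open>Otherwise the series would stall at its first term, which is not G, although
      it reaches G at \<open>c\<close>.\<close>
    have "\<not> upper_central G N (Suc (Suc 0)) \<subseteq> upper_central G N (Suc 0)"
    proof
      assume *: "upper_central G N (Suc (Suc 0)) \<subseteq> upper_central G N (Suc 0)"
      have "upper_central G N c \<subseteq> upper_central G N (Suc 0)"
        using upper_central_stable[OF *] N upper_central_mono[OF N(1), of 0 1]
        by (cases c) auto
      then show False using c False by auto
    qed
    \<comment> \<open>Being in the second term makes [y, x] central modulo \<open>N\<close>; being
      outside the first makes it non-trivial for some y.\<close>
    then obtain x where x: "x \<in> upper_central G N (Suc (Suc 0))" "x \<notin> upper_central G N (Suc 0)" by blast
    then have xc: "x \<in> carrier G" by simp
    have inv: "comm y x = inv (comm x y)" if "y \<in> carrier G" for y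
      using that xc by (simp add: inv_mult_group m_assoc)
    have Z: "subgroup (upper_central G N (Suc 0)) G"
      by (rule normal_imp_subgroup[OF normal_upper_central[OF N(1)]])
    have central: "comm (comm y x) z \<in> N" if "y \<in> carrier G" "z \<in> carrier G" for y z
    proof -
      have "comm x y \<in> upper_central G N (Suc 0)" using x(1) that(1) by (rule comm_upper_central)
      then have "comm y x \<in> upper_central G N (Suc 0)"
        unfolding inv[OF that(1)] by (rule subgroup.m_inv_closed[OF Z])
      from comm_upper_central[OF this that(2)] show ?thesis by simp
    qed
    define h where "h y = N #> comm y x" for y
    interpret h: group_hom G "G Mod N" h
      unfolding h_def
      by (rule q.group_hom_comm[OF xc]) (rule q_one[THEN iffD2], use xc central in simp_all)
    have "\<exists>y\<in>carrier G. comm x y \<notin> N" using x(2) xc by simp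
    then obtain y0 where y0: "y0 \<in> carrier G" "comm x y0 \<notin> N" by blast
    have "\<exists>f\<in>hom G integer_group. (\<exists>g\<in>carrier G. f g = 1) \<and>
           (\<forall>y\<in>carrier G. h y = \<one>\<^bsub>G Mod N\<^esub> \<longrightarrow> f y = 0)"
    proof (rule h.ex_int_hom_abelian_image[OF S])
      show "h y \<otimes>\<^bsub>G Mod N\<^esub> h z = h z \<otimes>\<^bsub>G Mod N\<^esub> h y" if "y \<in> carrier G" "z \<in> carrier G" for y z
        unfolding h_def using that xc central by (intro q_comm) auto
      show "h y = \<one>\<^bsub>G Mod N\<^esub>" if "y \<in> carrier G" "0 < n" "h y [^]\<^bsub>G Mod N\<^esub> n = \<one>\<^bsub>G Mod N\<^esub>" for y and n :: nat
        unfolding h_def by (rule tf) (use that xc in \<open>auto simp: h_def\<close>)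
      have "comm y0 x \<notin> N" using y0 xc inv N.m_inv_closed[of "comm y0 x"] by auto
      then show "h y0 \<noteq> \<one>\<^bsub>G Mod N\<^esub>" unfolding h_def by (subst q_one) (simp_all add: y0 xc)
    qed (rule y0)
    moreover have "h y = \<one>\<^bsub>G Mod N\<^esub>" if "y \<in> N" for y
    proof -
      have yc: "y \<in> carrier G" using that by (rule N.mem_carrier)
      have "comm y x = y \<otimes> (x \<otimes> inv y \<otimes> inv x)" using yc xc by (simp add: m_assoc)
      then have "comm y x \<in> N"
        using that N.m_closed N.inv_op_closed2[OF xc N.m_inv_closed[OF that]] by simp
      then show ?thesis unfolding h_def by (subst q_one) (simp_all add: yc xc)
    qed
    ultimately show ?thesis
      by (elim bexE) (rule bexI, auto simp: N.mem_carrier simp del: one_FactGroup)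
  qed
qed

section \<open>Automorphisms preserving all orderings\<close>

text \<open>Replaces the conditions on \<open>G Mod N\<close> by closure of \<open>N\<close> under
  roots and termination of its upper series, the form in which orders are built.\<close>

lemma (in group) residually_torsion_free_nilpotentE:
  assumes "residually_torsion_free_nilpotent G" "g \<in> carrier G" "g \<noteq> \<one>"
  obtains N c where "N \<lhd> G" "g \<notin> N" "upper_central G N c = carrier G"
    "\<And>x n. x \<in> carrier G \<Longrightarrow> n > 0 \<Longrightarrow> x [^] (n::nat) \<in> N \<Longrightarrow> x \<in> N"
proof -
  obtain N where N: "N \<lhd> G" and tf: "torsion_free_group (G Mod N)" and "nilpotent_group (G Mod N)"
    and g: "N #> g \<noteq> \<one>\<^bsub>G Mod N\<^esub>"
    using assms unfolding residually_torsion_free_nilpotent_def by blast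
  interpret N: normal N G by fact
  obtain c where "lower_central (G Mod N) c = {\<one>\<^bsub>G Mod N\<^esub>}"
    using \<open>nilpotent_group (G Mod N)\<close> unfolding nilpotent_group_def by blast
  then have c: "upper_central G N c = carrier G" by (rule upper_central_eq_carrier[OF N])
  have "g \<notin> N" using g unfolding N.rcos_eq_one_iff[OF assms(2)] .
  moreover have "x \<in> N" if x: "x \<in> carrier G" "n > 0" "x [^] n \<in> N" for x and n :: nat
  proof -
    have "N #> x \<in> carrier (G Mod N)" using x(1) by (auto simp: FactGroup_def RCOSETS_def)
    moreover have "(N #> x) [^]\<^bsub>G Mod N\<^esub> n = \<one>\<^bsub>G Mod N\<^esub>"
      unfolding N.FactGroup_pow[OF x(1)] using x by (subst N.rcos_eq_one_iff) simp_all
    ultimately have "N #> x = \<one>\<^bsub>G Mod N\<^esub>"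
      using tf x(2) unfolding torsion_free_group_def by blast
    then show ?thesis unfolding N.rcos_eq_one_iff[OF x(1)] .
  qed
  ultimately show ?thesis using that N c by blast
qed

text \<open>Reversing the order on the cosets of \<open>K\<close> while keeping the order on \<open>K\<close> separates an element of
  \<open>K\<close> from one outside \<open>K\<close>.\<close>

lemma (in group) same_sign_rel_convex:
  assumes P0: "rel_cone G (carrier G) {\<one>} P0"
    and ab: "a \<in> carrier G" "b \<in> carrier G"
    and same: "\<And>P. rel_cone G (carrier G) {\<one>} P \<Longrightarrow> a \<in> P \<longleftrightarrow> b \<in> P"
    and P: "rel_cone G (carrier G) K P"
    and "a \<in> K"
  shows "b \<in> K"
proof (cases "a = \<one>")
  case True
  \<comment> \<open>The identity lies in no cone, so \<open>b\<close> lies neither in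
    \<open>P0\<close> nor in its reverse and is the identity too.\<close>
  have one: "\<one> \<notin> P" if "rel_cone G (carrier G) {\<one>} P" for P
    using that by (simp add: rel_cone_def)
  have "b \<notin> P0" "b \<notin> m_inv G ` P0"
    using same one P0 rel_cone_flip[OF P0] True by blast+
  moreover have "b = \<one> \<or> b \<in> P0 \<or> inv b \<in> P0" using P0 ab(2) by (auto simp: rel_cone_def)
  moreover have "b = inv (inv b)" using ab by simp
  ultimately have "b = \<one>" by blast
  then show ?thesis using True \<open>a \<in> K\<close> by simp
next
  case False
  have K: "subgroup K G" "K \<subseteq> carrier G" and disj: "K \<inter> P = {}" using P by (auto simp: rel_cone_def)
  have "rel_cone G K {\<one>} (K \<inter> P0)"
    using rel_cone_restrict[OF P0 K] K(1) by (simp add: subgroup.one_closed Int_insert_right)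
  \<comment> \<open>Restricted to \<open>K\<close>, either \<open>P0\<close> or its reverse makes
    \<open>a\<close> positive.\<close>
  moreover have "a \<in> K \<inter> P0 \<or> a \<in> m_inv G ` (K \<inter> P0)"
  proof -
    have "a \<in> P0 \<or> inv a \<in> P0" using P0 ab(1) False by (auto simp: rel_cone_def)
    moreover have "inv a \<in> K" using K(1) \<open>a \<in> K\<close> by (rule subgroup.m_inv_closed)
    moreover have "a = inv (inv a)" using ab by simp
    ultimately show ?thesis using \<open>a \<in> K\<close> by blast
  qed
  ultimately obtain Q where Q: "rel_cone G K {\<one>} Q" "a \<in> Q"
    using rel_cone_flip by blast
  \<comment> \<open>Adding \<open>P\<close> or its reverse to \<open>Q\<close> gives two orders with
    \<open>a\<close> positive, hence with \<open>b\<close> positive. As \<open>b\<close> cannot lie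
    in both \<open>P\<close> and its reverse, it lies in \<open>Q\<close>.\<close>
  have "b \<in> P \<union> Q" using same[OF rel_cone_trans[OF P Q(1)]] Q(2) by blast
  moreover have "b \<in> m_inv G ` P \<union> Q"
    using same[OF rel_cone_trans[OF rel_cone_flip[OF P] Q(1)]] Q(2) by blast
  moreover have "\<not> (b \<in> P \<and> b \<in> m_inv G ` P)"
  proof
    assume b: "b \<in> P \<and> b \<in> m_inv G ` P"
    then obtain p where "p \<in> P" "b = inv p" by blast
    then show False using b rel_cone_inv_notin[OF P, of p] by simp
  qed
  ultimately have "b \<in> Q" by blast
  then show ?thesis using Q(1) by (auto simp: rel_cone_def)
qed

text \<open>Completing \<open>P\<close> by \<open>P0\<close> inside \<open>K\<close> leaves
  \<open>b\<close> in \<open>P\<close> or in \<open>K\<close>; the latter would put \<open>a\<close>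
  in \<open>K\<close> by \<open>same_sign_rel_convex\<close> with \<open>a\<close> and
  \<open>b\<close> exchanged.\<close>

lemma (in group) same_sign_rel_cone:
  assumes P0: "rel_cone G (carrier G) {\<one>} P0"
    and ab: "a \<in> carrier G" "b \<in> carrier G"
    and same: "\<And>P. rel_cone G (carrier G) {\<one>} P \<Longrightarrow> a \<in> P \<longleftrightarrow> b \<in> P"
    and P: "rel_cone G (carrier G) K P"
    and "a \<in> P"
  shows "b \<in> P"
proof -
  have K: "subgroup K G" "K \<subseteq> carrier G" and disj: "K \<inter> P = {}" using P by (auto simp: rel_cone_def)
  have "rel_cone G K {\<one>} (K \<inter> P0)"
    using rel_cone_restrict[OF P0 K] K(1) by (simp add: subgroup.one_closed Int_insert_right)
  then have "b \<in> P \<union> (K \<inter> P0)"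
    using same[OF rel_cone_trans[OF P]] \<open>a \<in> P\<close> by blast
  moreover have "b \<notin> K"
    using same_sign_rel_convex[OF P0 ab(2,1) _ P] same disj \<open>a \<in> P\<close> by blast
  ultimately show ?thesis by blast
qed

text \<open>Elements of degree one generate: x is the product of x g^(1 - f x), which has degree
  one, and a power of g.\<close>

lemma group_hom_eqI_degree_one:
  assumes h: "group_hom G H h" "group_hom G H k" and f: "group_hom G integer_group f"
    and g: "g \<in> carrier G" "f g = 1"
    and eq: "\<And>x. x \<in> carrier G \<Longrightarrow> f x = 1 \<Longrightarrow> h x = k x"
    and x: "x \<in> carrier G"
  shows "h x = k x"
proof -
  interpret h: group_hom G H h by fact
  interpret k: group_hom G H k by fact
  interpret f: group_hom G integer_group f by fact
  define y where "y = x \<otimes>\<^bsub>G\<^esub> g [^]\<^bsub>G\<^esub> (1 - f x)"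
  have y: "y \<in> carrier G" "f y = 1" using x g by (simp_all add: y_def f.hom_int_pow)
  have "x = y \<otimes>\<^bsub>G\<^esub> g [^]\<^bsub>G\<^esub> (f x - 1)"
    using x g by (simp add: y_def h.G.m_assoc flip: h.G.int_pow_mult)
  then show ?thesis
    using eq[OF y] eq[OF g] y g by (metis h.hom_int_pow h.hom_mult h.G.int_pow_closed k.hom_int_pow k.hom_mult)
qed

lemma (in group) order_preserving_hom_eq:
  assumes P0: "rel_cone G (carrier G) {\<one>} P0"
    and \<alpha>: "group_hom G G \<alpha>" "\<alpha> ` carrier G = carrier G"
    and same: "\<And>P x. rel_cone G (carrier G) {\<one>} P \<Longrightarrow> x \<in> carrier G \<Longrightarrow> x \<in> P \<longleftrightarrow> \<alpha> x \<in> P"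
    and S: "finite S" "S \<subseteq> carrier G" "generate G S = carrier G"
    and N: "N \<lhd> G" "N \<noteq> carrier G" "upper_central G N c = carrier G"
    and isolated: "\<And>x n. x \<in> carrier G \<Longrightarrow> n > 0 \<Longrightarrow> x [^] (n::nat) \<in> N \<Longrightarrow> x \<in> N"
    and x: "x \<in> carrier G"
  shows "N #> \<alpha> x = N #> x"
proof -
  interpret N: normal N G by fact
  interpret \<alpha>: group_hom G G \<alpha> by fact
  have "\<exists>f\<in>hom G integer_group. (\<exists>g\<in>carrier G. f g = 1) \<and> (\<forall>x\<in>N. f x = 0)"
    by (rule ex_int_hom_nilpotent_quotient[OF S N(1,2) _ N(3)]) (fact isolated)
  then obtain f g0 where f: "f \<in> hom G integer_group" and g0: "g0 \<in> carrier G" "f g0 = 1"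
    and fN: "\<And>x. x \<in> N \<Longrightarrow> f x = 0"
    by blast
  interpret f: group_hom G integer_group f
    by (simp add: group_hom_def group_hom_axioms_def f)
  \<comment> \<open>Having the same sign is symmetric, so this holds in both directions; the forward
    one places the preimage \<open>y\<close> of g in \<open>K\<close> below.\<close>
  have invariant: "\<alpha> y \<in> K \<longleftrightarrow> y \<in> K" if K: "rel_cone G (carrier G) K P" and y: "y \<in> carrier G" for K P y
    using same_sign_rel_convex[OF P0 y \<alpha>.hom_closed[OF y] same[OF _ y] K]
      same_sign_rel_convex[OF P0 \<alpha>.hom_closed[OF y] y same[OF _ y, symmetric] K] by blast
  have "\<exists>P. rel_cone G (carrier G) N P"
    by (rule rel_cone_nilpotent_quotient[OF N(1) _ N(3)]) (fact isolated)
  then obtain P where P: "rel_cone G (carrier G) N P" by blast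
  have degree_one: "N #> \<alpha> g = N #> g" if g: "g \<in> carrier G" "f g = 1" for g
  proof -
    define K where "K = {x \<in> carrier G. x \<otimes> inv (g [^] f x) \<in> N}"
    have "\<exists>P. rel_cone G (carrier G) K P"
      unfolding K_def by (rule rel_cone_cyclic_extension[OF N(1) _ N(3) f g]) (fact isolated)
    then obtain P' where K: "rel_cone G (carrier G) K P'" by blast
    have "g \<in> \<alpha> ` carrier G" using \<alpha>(2) g(1) by simp
    then obtain y where y: "y \<in> carrier G" "\<alpha> y = g" by blast
    have gK: "g \<in> K" using g by (simp add: K_def)
    \<comment> \<open>The exponents modulo \<open>N\<close> of \<alpha> g and of a preimage of g, as
      powers of g; applying \<alpha> and then f shows that they are mutually inverse.\<close>
    define a b where "a = f (\<alpha> g)" and "b = f y"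
    have \<alpha>g: "\<alpha> g \<otimes> inv (g [^] a) \<in> N"
      using invariant[OF K g(1)] gK by (simp add: K_def a_def)
    have "y \<otimes> inv (g [^] b) \<in> N"
      using invariant[OF K y(1)] y gK by (simp add: K_def b_def)
    then have "\<alpha> (y \<otimes> inv (g [^] b)) \<in> N"
      using invariant[OF P] by simp
    then have "f (\<alpha> (y \<otimes> inv (g [^] b))) = 0" by (rule fN)
    then have "b * a = 1" using y g by (simp add: \<alpha>.hom_int_pow f.hom_int_pow a_def)
    then have "a = 1 \<or> a = -1" by (auto simp: zmult_eq_1_iff)
    moreover have "a \<noteq> -1"
    proof
      \<comment> \<open>Then the product of \<alpha> g and g lies in \<open>N\<close>, yet both
        factors are positive for one cone relative to \<open>N\<close>.\<close>
      assume a: "a = -1"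
      have "g \<notin> N" using fN[of g] g by auto
      then have "g \<in> P \<or> g \<in> m_inv G ` P"
        using P g(1) unfolding rel_cone_def by (metis image_eqI inv_inv)
      then obtain Q where Q: "rel_cone G (carrier G) N Q" "g \<in> Q"
        using P rel_cone_flip[OF P] by blast
      have "\<alpha> g \<in> Q"
        using same_sign_rel_cone[OF P0 g(1) \<alpha>.hom_closed[OF g(1)] same[OF _ g(1)] Q] .
      then have "\<alpha> g \<otimes> g \<in> Q" using Q by (simp add: rel_cone_def)
      moreover have "\<alpha> g \<otimes> g \<in> N" using \<alpha>g g(1) by (simp add: a int_pow_neg)
      ultimately show False using Q(1) by (auto simp: rel_cone_def)
    qed
    ultimately have "\<alpha> g \<otimes> inv g \<in> N" using \<alpha>g g(1) by simp
    then show ?thesis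
      using g(1) by (intro coset_mult_inv1 coset_join2) (auto simp: N.subset N.is_subgroup)
  qed
  show ?thesis
  proof (rule group_hom_eqI_degree_one[of G "G Mod N" "\<lambda>x. N #> \<alpha> x" "\<lambda>x. N #> x" f g0])
    show "group_hom G (G Mod N) (\<lambda>x. N #> \<alpha> x)"
      using Group.hom_compose[OF \<alpha>.homh N.r_coset_hom_Mod]
      by (simp add: group_hom_def group_hom_axioms_def N.factorgroup_is_group o_def)
  qed (use x g0 degree_one in \<open>auto intro: N.rcos_group_hom f.group_hom_axioms\<close>)
qed

section \<open>The action on the space of orderings\<close>

lemma (in group) rel_cone_left_order:
  assumes P: "rel_cone G (carrier G) {\<one>} P"
  shows "{(a, b) \<in> carrier G \<times> carrier G. a = b \<or> inv a \<otimes> b \<in> P} \<in> left_orders G"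
proof -
  have PP: "\<And>x y. x \<in> P \<Longrightarrow> y \<in> P \<Longrightarrow> x \<otimes> y \<in> P" and one: "\<one> \<notin> P"
    and total: "\<And>x. x \<in> carrier G \<Longrightarrow> x = \<one> \<or> x \<in> P \<or> inv x \<in> P"
    using P by (auto simp: rel_cone_def)
  let ?R = "{(a, b) \<in> carrier G \<times> carrier G. a = b \<or> inv a \<otimes> b \<in> P}"
  have "inv a \<otimes> c \<in> P"
    if "a \<in> carrier G" "b \<in> carrier G" "c \<in> carrier G" "inv a \<otimes> b \<in> P" "inv b \<otimes> c \<in> P" for a b c
    using PP[OF that(4,5)] that(1-3) by (simp add: m_assoc)
  then have "trans ?R" unfolding trans_def by blast
  moreover have "antisym ?R"
  proof (rule antisymI, rule ccontr)
    fix a b assume ab: "(a, b) \<in> ?R" "(b, a) \<in> ?R" "a \<noteq> b"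
    then have "(inv a \<otimes> b) \<otimes> (inv b \<otimes> a) \<in> P" using PP by auto
    moreover have "(inv a \<otimes> b) \<otimes> (inv b \<otimes> a) = \<one>" using ab by (auto simp: m_assoc)
    ultimately show False using one by simp
  qed
  moreover have "total_on (carrier G) ?R"
  proof (rule total_onI)
    fix a b assume ab: "a \<in> carrier G" "b \<in> carrier G" "a \<noteq> b"
    have "inv (inv a \<otimes> b) = inv b \<otimes> a" using ab by (simp add: inv_mult_group)
    moreover have "inv a \<otimes> b \<noteq> \<one>" using ab by (metis inv_equality inv_inv inv_closed)
    ultimately show "(a, b) \<in> ?R \<or> (b, a) \<in> ?R" using total[of "inv a \<otimes> b"] ab by auto
  qed
  moreover have "inv (c \<otimes> a) \<otimes> (c \<otimes> b) = inv a \<otimes> b"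
    if "a \<in> carrier G" "b \<in> carrier G" "c \<in> carrier G" for a b c
    using that by (simp add: inv_mult_group m_assoc)
  ultimately show ?thesis
    unfolding left_orders_def order_on_defs by (auto simp: refl_on_def)
qed

section \<open>Pulling orders back along automorphisms\<close>

lemma (in group) auto_inverse:
  assumes "\<phi> \<in> auto G"
  shows "restrict (inv_into (carrier G) \<phi>) (carrier G) \<in> auto G"
  using assms restrict_inv_into_Bij restrict_inv_into_hom unfolding auto_def by blast

lemma (in group) psi_a_left_orders:
  assumes \<phi>: "\<phi> \<in> auto G" and R: "R \<in> left_orders G"
  shows "psi_a G \<phi> R \<in> left_orders G"
proof -
  interpret \<phi>: group_hom G G \<phi> using \<phi> by (simp add: group_hom_def group_hom_axioms_def auto_def)
  have inj: "\<phi> a = \<phi> b \<longleftrightarrow> a = b" if "a \<in> carrier G" "b \<in> carrier G" for a b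
    using \<phi> that unfolding auto_def Bij_def bij_betw_def inj_on_def by blast
  have lin: "refl_on (carrier G) R" "trans R" "antisym R" "total_on (carrier G) R"
    and left: "\<And>a b c. a \<in> carrier G \<Longrightarrow> b \<in> carrier G \<Longrightarrow> c \<in> carrier G \<Longrightarrow> (a, b) \<in> R
      \<Longrightarrow> (c \<otimes> a, c \<otimes> b) \<in> R"
    using R by (auto simp: left_orders_def order_on_defs)
  let ?R = "{(g, h) \<in> carrier G \<times> carrier G. (\<phi> g, \<phi> h) \<in> R}"
  have "refl_on (carrier G) ?R" using lin(1) by (auto simp: refl_on_def)
  moreover have "trans ?R" using lin(2) unfolding trans_def by blast
  moreover have "antisym ?R" using lin(3) inj unfolding antisym_def by blast
  moreover have "total_on (carrier G) ?R" using lin(4) inj by (auto simp: total_on_def)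
  moreover have "(c \<otimes> a, c \<otimes> b) \<in> ?R"
    if "a \<in> carrier G" "b \<in> carrier G" "c \<in> carrier G" "(a, b) \<in> ?R" for a b c
    using that left[of "\<phi> a" "\<phi> b" "\<phi> c"] by auto
  ultimately have "?R \<in> left_orders G" unfolding left_orders_def order_on_defs by blast
  then show ?thesis using R by (simp add: psi_a_def)
qed

text \<open>The map permutes coordinates: the coordinate at g of the pulled-back order is the
  coordinate at \<phi> g of the original.\<close>

lemma (in group) continuous_map_psi_a:
  assumes \<phi>: "\<phi> \<in> auto G"
  shows "continuous_map (LO G) (LO G) (psi_a G \<phi>)"
proof -
  interpret \<phi>: group_hom G G \<phi> using \<phi> by (simp add: group_hom_def group_hom_axioms_def auto_def)
  have "inj_on \<phi> (carrier G)" using \<phi> by (simp add: auto_def Bij_def bij_betw_def)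
  then have inj: "\<phi> a = \<one> \<longleftrightarrow> a = \<one>" if "a \<in> carrier G" for a
    using that inj_on_eq_iff[of \<phi> "carrier G" a \<one>] by simp
  define e where "e R = (\<lambda>g\<in>carrier G. g \<in> positive_cone G R)" for R
  define X where "X = product_topology (\<lambda>_. discrete_topology (UNIV :: bool set)) (carrier G)"
  have LO: "LO G = pullback_topology (left_orders G) e X"
    by (simp add: LO_def e_def[abs_def] X_def)
  have "continuous_map (LO G) X (id \<circ> e)"
    unfolding LO by (rule continuous_map_pullback) simp
  then have coord: "continuous_map (LO G) (discrete_topology UNIV) (\<lambda>R. e R g)" if "g \<in> carrier G" for g
    using that unfolding X_def by (simp add: continuous_map_componentwise)
  have e_psi: "e (psi_a G \<phi> R) g = e R (\<phi> g)" if "R \<in> left_orders G" "g \<in> carrier G" for R g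
    using that inj[OF that(2)] by (auto simp: e_def positive_cone_def psi_a_def)
  have "continuous_map (LO G) X (e \<circ> psi_a G \<phi>)"
    unfolding X_def continuous_map_componentwise
  proof (intro conjI ballI)
    show "(e \<circ> psi_a G \<phi>) ` topspace (LO G) \<subseteq> extensional (carrier G)"
      by (auto simp: e_def)
    show "continuous_map (LO G) (discrete_topology UNIV) (\<lambda>R. (e \<circ> psi_a G \<phi>) R g)" if "g \<in> carrier G" for g
      by (rule continuous_map_eq[OF coord[OF \<phi>.hom_closed[OF that]]]) (simp add: e_psi that)
  qed
  then show ?thesis
    unfolding LO
    by (rule continuous_map_pullback')
      (use psi_a_left_orders[OF \<phi>] in \<open>auto simp flip: LO\<close>)
qed

text \<open>Pulling back reverses composition, hence the hypothesis on \<psi> \<circ>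
  \<phi>.\<close>

lemma (in group) psi_a_inverse:
  assumes "R \<in> left_orders G" "psi_a G \<psi> R \<in> left_orders G"
    and "\<And>x. x \<in> carrier G \<Longrightarrow> \<phi> x \<in> carrier G" "\<And>x. x \<in> carrier G \<Longrightarrow> \<psi> (\<phi> x) = x"
  shows "psi_a G \<phi> (psi_a G \<psi> R) = R"
proof -
  have "R \<subseteq> carrier G \<times> carrier G" using assms(1) by (auto simp: left_orders_def order_on_defs)
  moreover have "psi_a G \<phi> (psi_a G \<psi> R) =
    {(g, h) \<in> carrier G \<times> carrier G. (\<phi> g, \<phi> h) \<in> psi_a G \<psi> R}"
    using assms(2) by (simp add: psi_a_def)
  moreover have "psi_a G \<psi> R = {(g, h) \<in> carrier G \<times> carrier G. (\<psi> g, \<psi> h) \<in> R}"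
    using assms(1) by (simp add: psi_a_def)
  ultimately show ?thesis using assms(3,4) by auto
qed

lemma (in group) psi_a_Homeo:
  assumes \<phi>: "\<phi> \<in> auto G"
  shows "psi_a G \<phi> \<in> Homeo (LO G)"
proof -
  define \<psi> where "\<psi> = restrict (inv_into (carrier G) \<phi>) (carrier G)"
  have \<psi>: "\<psi> \<in> auto G" unfolding \<psi>_def using \<phi> by (rule auto_inverse)
  have bij: "bij_betw \<phi> (carrier G) (carrier G)" using \<phi> by (simp add: auto_def Bij_def)
  have inv: "\<phi> x \<in> carrier G" "\<psi> x \<in> carrier G" "\<psi> (\<phi> x) = x" "\<phi> (\<psi> x) = x" if "x \<in> carrier G" for x
    using bij that bij_betwE[OF bij] bij_betw_inv_into[OF bij, THEN bij_betwE]
    by (simp_all add: \<psi>_def bij_betw_inv_into_left bij_betw_inv_into_right)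
  have "homeomorphic_maps (LO G) (LO G) (psi_a G \<phi>) (psi_a G \<psi>)"
    unfolding homeomorphic_maps_def
    using continuous_map_psi_a[OF \<phi>] continuous_map_psi_a[OF \<psi>] psi_a_left_orders[OF \<phi>]
      psi_a_left_orders[OF \<psi>] psi_a_inverse inv by auto
  then show ?thesis
    by (auto simp: Homeo_def psi_a_def dest: homeomorphic_maps_imp_map)
qed

section \<open>Injectivity of the action\<close>

theorem theorem1p1:
  fixes G :: "('a, 'b) monoid_scheme"
  assumes "group G"
    and "finitely_generated_group G"
    and "residually_torsion_free_nilpotent G"
  shows "psi_a G \<in> auto G \<rightarrow> Homeo (LO G) \<and> inj_on (psi_a G) (auto G)"
proof
  interpret group G by fact
  obtain S where S: "finite S" "S \<subseteq> carrier G" "generate G S = carrier G"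
    using assms(2) unfolding finitely_generated_group_def by blast
  show "psi_a G \<in> auto G \<rightarrow> Homeo (LO G)" using psi_a_Homeo by blast
  obtain P0 where P0: "rel_cone G (carrier G) {\<one>\<^bsub>G\<^esub>} P0"
  proof (rule rel_cone_residual)
    show "\<exists>K P. rel_cone G (carrier G) K P \<and> x \<notin> K" if x: "x \<in> carrier G" "x \<noteq> \<one>\<^bsub>G\<^esub>" for x
    proof -
      obtain N c where N: "N \<lhd> G" "x \<notin> N" "upper_central G N c = carrier G"
        "\<And>x n. x \<in> carrier G \<Longrightarrow> n > 0 \<Longrightarrow> x [^]\<^bsub>G\<^esub> (n::nat) \<in> N \<Longrightarrow> x \<in> N"
        using residually_torsion_free_nilpotentE[OF assms(3) x] by blast
      have "\<exists>P. rel_cone G (carrier G) N P"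
        by (rule rel_cone_nilpotent_quotient[OF N(1) _ N(3)]) (fact N(4))
      then show ?thesis using N(2) by blast
    qed
  qed
  show "inj_on (psi_a G) (auto G)"
  proof (rule inj_onI)
    fix \<phi> \<psi> assume \<phi>: "\<phi> \<in> auto G" and \<psi>: "\<psi> \<in> auto G" and eq: "psi_a G \<phi> = psi_a G \<psi>"
    have bij: "bij_betw \<phi> (carrier G) (carrier G)" "bij_betw \<psi> (carrier G) (carrier G)"
      using \<phi> \<psi> by (auto simp: auto_def Bij_def)
    interpret \<phi>: group_hom G G \<phi> using \<phi> by (simp add: group_hom_def group_hom_axioms_def auto_def)
    interpret \<psi>: group_hom G G \<psi> using \<psi> by (simp add: group_hom_def group_hom_axioms_def auto_def)
    have inj: "\<phi> g = \<one>\<^bsub>G\<^esub> \<longleftrightarrow> g = \<one>\<^bsub>G\<^esub>" "\<psi> g = \<one>\<^bsub>G\<^esub> \<longleftrightarrow> g = \<one>\<^bsub>G\<^esub>" if "g \<in> carrier G" for g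
      using inj_on_eq_iff[OF bij_betw_imp_inj_on[OF bij(1)] that one_closed]
        inj_on_eq_iff[OF bij_betw_imp_inj_on[OF bij(2)] that one_closed] by simp_all
    have same: "\<psi> g \<in> P \<longleftrightarrow> \<phi> g \<in> P"
      if P: "rel_cone G (carrier G) {\<one>\<^bsub>G\<^esub>} P" and g: "g \<in> carrier G" for P g
    proof -
      \<comment> \<open>The order with cone \<open>P\<close>: comparing the two pullbacks at the
        pair (1, g) compares the signs of \<phi> g and \<psi> g.\<close>
      define R where "R = {(a, b) \<in> carrier G \<times> carrier G. a = b \<or> inv\<^bsub>G\<^esub> a \<otimes>\<^bsub>G\<^esub> b \<in> P}"
      have R: "R \<in> left_orders G" unfolding R_def using P by (rule rel_cone_left_order)
      have one: "\<one>\<^bsub>G\<^esub> \<notin> P" using P by (simp add: rel_cone_def)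
      have pos: "x \<in> P \<longleftrightarrow> (\<one>\<^bsub>G\<^esub>, x) \<in> R \<and> x \<noteq> \<one>\<^bsub>G\<^esub>" if "x \<in> carrier G" for x
        using that one by (auto simp: R_def)
      have "(\<one>\<^bsub>G\<^esub>, g) \<in> psi_a G \<phi> R \<longleftrightarrow> (\<one>\<^bsub>G\<^esub>, g) \<in> psi_a G \<psi> R" by (simp add: eq)
      then have "(\<one>\<^bsub>G\<^esub>, \<phi> g) \<in> R \<longleftrightarrow> (\<one>\<^bsub>G\<^esub>, \<psi> g) \<in> R"
        using R g by (simp add: psi_a_def)
      then show ?thesis using pos g inj[OF g] by simp
    qed
    define \<psi>' where "\<psi>' = restrict (inv_into (carrier G) \<psi>) (carrier G)"
    have \<psi>': "\<psi>' \<in> auto G" unfolding \<psi>'_def using \<psi> by (rule auto_inverse)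
    then have bij': "bij_betw \<psi>' (carrier G) (carrier G)" by (simp add: auto_def Bij_def)
    have \<psi>\<psi>': "\<psi> (\<psi>' x) = x" if "x \<in> carrier G" for x
      using bij that by (simp add: \<psi>'_def bij_betw_inv_into_right)
    have \<psi>'\<psi>: "\<psi>' (\<psi> x) = x" if "x \<in> carrier G" for x
      using bij that by (simp add: \<psi>'_def bij_betw_inv_into_left)
    \<comment> \<open>Substituting the preimage of x under \<psi> into \<open>same\<close> shows
      that this composite preserves all cones; it is the identity exactly when \<phi> and \<psi>
      agree.\<close>
    define \<alpha> where "\<alpha> = \<phi> \<circ> \<psi>'"
    have "bij_betw \<alpha> (carrier G) (carrier G)"
      unfolding \<alpha>_def by (rule bij_betw_trans[OF bij' bij(1)])
    moreover have "\<alpha> \<in> hom G G"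
      unfolding \<alpha>_def using \<psi>' \<phi> by (intro Group.hom_compose) (auto simp: auto_def)
    ultimately have \<alpha>: "group_hom G G \<alpha>" "\<alpha> ` carrier G = carrier G"
      by (auto simp: group_hom_def group_hom_axioms_def bij_betw_def)
    interpret \<alpha>: group_hom G G \<alpha> by fact
    have \<alpha>_same: "x \<in> P \<longleftrightarrow> \<alpha> x \<in> P"
      if "rel_cone G (carrier G) {\<one>\<^bsub>G\<^esub>} P" "x \<in> carrier G" for P x
      using same[OF that(1), of "\<psi>' x"] bij_betwE[OF bij'] \<psi>\<psi>'[OF that(2)] that(2) by (simp add: \<alpha>_def)
    have \<alpha>_id: "\<alpha> x = x" if x: "x \<in> carrier G" for x
    proof (rule ccontr)
      \<comment> \<open>If \<open>z\<close> survives modulo \<open>N\<close>, then \<alpha> x and x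
        lie in different cosets of \<open>N\<close>.\<close>
      define z where "z = \<alpha> x \<otimes>\<^bsub>G\<^esub> inv\<^bsub>G\<^esub> x"
      assume "\<alpha> x \<noteq> x"
      then have z: "z \<in> carrier G" "z \<noteq> \<one>\<^bsub>G\<^esub>"
        using x inv_equality[of "\<alpha> x" "inv\<^bsub>G\<^esub> x"] by (auto simp: z_def)
      obtain N c where N: "N \<lhd> G" "z \<notin> N" "upper_central G N c = carrier G"
        "\<And>x n. x \<in> carrier G \<Longrightarrow> n > 0 \<Longrightarrow> x [^]\<^bsub>G\<^esub> (n::nat) \<in> N \<Longrightarrow> x \<in> N"
        using residually_torsion_free_nilpotentE[OF assms(3) z] by blast
      have "N \<noteq> carrier G" using N(2) z(1) by blast
      have "N #>\<^bsub>G\<^esub> \<alpha> x = N #>\<^bsub>G\<^esub> x"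
        by (rule order_preserving_hom_eq[OF P0 \<alpha> _ S N(1) \<open>N \<noteq> carrier G\<close> N(3) _ x])
          (fact \<alpha>_same, fact N(4))
      moreover have "subgroup N G" using N(1) by (rule normal_imp_subgroup)
      ultimately have "z \<in> N"
        unfolding z_def using x coset_mult_inv2 coset_join1 subgroup.subset
        by (metis \<alpha>.hom_closed inv_closed m_closed)
      then show False using N(2) by simp
    qed
    show "\<phi> = \<psi>"
    proof (rule extensionalityI[of _ "carrier G"])
      show "\<phi> x = \<psi> x" if "x \<in> carrier G" for x
        using \<alpha>_id[of "\<psi> x"] \<psi>'\<psi>[OF that] that by (simp add: \<alpha>_def)
    qed (use \<phi> \<psi> in \<open>auto simp: auto_def Bij_def\<close>)
  qed
qed

end
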